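(* Let $\mathbf A$ be a real $n\times n$ matrix. The following are equivalent: (1) $\mathbf A$ has the total signature equality property; (2) for every $j=1,\dots,n$, $\mathbf A^{(j)}$ has the signature equality property; (3) for every $j=1,\dots,n$, $\mathbf A^{(j)}$ is eventually SJS; (4) $\mathbf A$ is eventually strictly totally $J$-sign-symmetric.
   Context: The $j$th compound matrix $\mathbf A^{(j)}$ is the $\binom nj\times\binom nj$ matrix of all $j\times j$ minors of $\mathbf A$ with row and column index sets in lexicographic order. For $x_1,\dots,x_j\in\mathbb R^n$, the exterior product $x_1\wedge\dots\wedge x_j\in\mathbb R^{\binom nj}$ has as coordinate number $\alpha$ the determinant $\det(x_s^{i_r})_{r,s=1}^j$, where $(i_1<\dots<i_j)$ is the $\alpha$th index set in lexicographic order. For $x\in\mathbb R^m$, $\mathrm{Sign}(x)=(\mathrm{sgn}(x^1),\dots,\mathrm{sgn}(x^m))$. An eigenfunctional of a matrix for eigenvalue $\lambda$ is an eigenvector of its transpose for $\lambda$. For a real $m\times m$ matrix $\mathbf B=\{b_{ij}\}$ and $J\subseteq[m]$, $J^c=[m]\setminus J$, $\mathbf B$ is strictly $J$-sign-symmetric if $b_{ij}>0$ on $(J\times J)\cup(J^c\times J^c)$ and $b_{ij}<0$ on $(J\times J^c)\cup(J^c\times J)$; $\mathbf B$ is SJS if this holds for some $J\subseteq[m]$; $\mathbf B$ is eventually SJS if there is $k_0$ with $\mathbf B^k$ SJS for all $k\ge k_0$. $\mathbf B$ has the signature equality property if it has a simple positive eigenvalue $\lambda$ with $\lambda>|\mu|$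 for every other eigenvalue $\mu$, whose eigenvector $x$ and eigenfunctional $x^*$ have no zero coordinates and can be chosen with $\mathrm{Sign}(x)=\mathrm{Sign}(x^* )$. $\mathbf A$ is strictly totally $J$-sign-symmetric (STJS) if for every $j=1,\dots,n$ the matrix $\mathbf A^{(j)}$ is SJS (with respect to some subset of its index set $[\binom nj]$); $\mathbf A$ is eventually STJS if there is $k_0$ with $\mathbf A^k$ STJS for all $k\ge k_0$. $\mathbf A$ has the total signature equality property if it has $n$ positive simple eigenvalues $\lambda_1>\dots>\lambda_n>0$ whose eigenvectors $x_1,\dots,x_n$ and eigenfunctionals $x_1^*,\dots,x_n^*$ can be chosen so that for all $j=1,\dots,n$, $x_1\wedge\dots\wedge x_j$ and $x_1^*\wedge\dots\wedge x_j^*$ have no zero coordinates and $\mathrm{Sign}(x_1\wedge\dots\wedge x_j)=\mathrm{Sign}(x_1^*\wedge\dots\wedge x_j^* )$. *)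

theory Defs
  imports "Jordan_Normal_Form.Char_Poly" "Jordan_Normal_Form.Determinant"
begin

text \<open>Index sets: all strictly increasing lists of length j with entries in [a..<n],
  enumerated in lexicographic order.\<close>
fun combs :: "nat \<Rightarrow> nat \<Rightarrow> nat \<Rightarrow> nat list list" where
  "combs a n 0 = [[]]"
| "combs a n (Suc j) = concat (map (\<lambda>i. map (Cons i) (combs (Suc i) n j)) [a..<n])"

definition index_sets :: "nat \<Rightarrow> nat \<Rightarrow> nat list list" where
  "index_sets n j = combs 0 n j"

definition compound :: "real mat \<Rightarrow> nat \<Rightarrow> real mat" where
  "compound A j = (let n = dim_row A; I = index_sets n j in
     mat (n choose j) (n choose j)
       (\<lambda>(a, b). det (mat j j (\<lambda>(r, s). A $$ (I ! a ! r, I ! b ! s)))))"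

definition ext_prod :: "nat \<Rightarrow> real vec list \<Rightarrow> real vec" where
  "ext_prod n xs = (let j = length xs; I = index_sets n j in
     vec (n choose j) (\<lambda>a. det (mat j j (\<lambda>(r, s). (xs ! s) $ (I ! a ! r)))))"

definition Sign :: "real vec \<Rightarrow> real vec" where
  "Sign x = map_vec sgn x"

definition no_zero_coords :: "real vec \<Rightarrow> bool" where
  "no_zero_coords x = (\<forall>i < dim_vec x. x $ i \<noteq> 0)"

definition SJS :: "real mat \<Rightarrow> bool" where
  "SJS B = (\<exists>J \<subseteq> {..<dim_row B}. \<forall>i < dim_row B. \<forall>k < dim_row B.
      ((i \<in> J \<longleftrightarrow> k \<in> J) \<longrightarrow> B $$ (i, k) > 0) \<and>
      (\<not> (i \<in> J \<longleftrightarrow> k \<in> J) \<longrightarrow> B $$ (i, k) < 0))"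

definition eventually_SJS :: "real mat \<Rightarrow> bool" where
  "eventually_SJS B = (\<exists>k0. \<forall>k \<ge> k0. SJS (B ^\<^sub>m k))"

definition simple_eigenvalue :: "real mat \<Rightarrow> real \<Rightarrow> bool" where
  "simple_eigenvalue B l = (eigenvalue B l \<and> order l (char_poly B) = 1)"

definition signature_equality :: "real mat \<Rightarrow> bool" where
  "signature_equality B = (\<exists>l > 0. simple_eigenvalue B l \<and>
     (\<forall>\<mu>::complex. eigenvalue (map_mat complex_of_real B) \<mu> \<and> \<mu> \<noteq> complex_of_real l
         \<longrightarrow> cmod \<mu> < l) \<and>
     (\<exists>x xs. eigenvector B x l \<and> eigenvector (transpose_mat B) xs l \<and>
        no_zero_coords x \<and> no_zero_coords xs \<and> Sign x = Sign xs))"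

definition STJS :: "real mat \<Rightarrow> bool" where
  "STJS A = (\<forall>j \<in> {1..dim_row A}. SJS (compound A j))"

definition eventually_STJS :: "real mat \<Rightarrow> bool" where
  "eventually_STJS A = (\<exists>k0. \<forall>k \<ge> k0. STJS (A ^\<^sub>m k))"

definition total_signature_equality :: "real mat \<Rightarrow> bool" where
  "total_signature_equality A = (let n = dim_row A in
     \<exists>(l :: nat \<Rightarrow> real) (x :: nat \<Rightarrow> real vec) (y :: nat \<Rightarrow> real vec).
       (\<forall>i < n. simple_eigenvalue A (l i) \<and> l i > 0 \<and>
          eigenvector A (x i) (l i) \<and> eigenvector (transpose_mat A) (y i) (l i)) \<and>
       (\<forall>i j. i < j \<and> j < n \<longrightarrow> l i > l j) \<and>
       (\<forall>j \<in> {1..n}.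
          no_zero_coords (ext_prod n (map x [0..<j])) \<and>
          no_zero_coords (ext_prod n (map y [0..<j])) \<and>
          Sign (ext_prod n (map x [0..<j])) = Sign (ext_prod n (map y [0..<j]))))"

end

theory Submission
  imports Defs "Jordan_Normal_Form.Spectral_Radius"
begin

text \<open>
  By Cauchy--Binet, compounds are multiplicative, so \<open>(A\<^sup>k)\<^sup>(\<^sup>j\<^sup>) = (A\<^sup>(\<^sup>j\<^sup>))\<^sup>k\<close>, the eigenvalues of
  \<open>A\<^sup>(\<^sup>j\<^sup>)\<close> are the products of \<open>j\<close> eigenvalues of \<open>A\<close> (compounds of triangular matrices are
  triangular), and \<open>x\<^sub>1 \<and> \<dots> \<and> x\<^sub>j\<close> is an eigenvector of \<open>A\<^sup>(\<^sup>j\<^sup>)\<close> for \<open>\<lambda>\<^sub>1 \<dots> \<lambda>\<^sub>j\<close>.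
  If all compounds have a strictly dominant simple positive eigenvalue, then comparing these
  eigenvalues for consecutive \<open>j\<close> forces the eigenvalues of \<open>A\<close> to be positive and distinct.

  For a single matrix \<open>B\<close>, signature equality gives \<open>B\<^sup>k / \<lambda>\<^sup>k \<rightarrow> x y\<^sup>T / (y\<^sup>T x)\<close>, whose sign pattern is strictly
  sign-symmetric. Conversely, each late power of \<open>B\<close> is a positive matrix up to a diagonal
  signature similarity, so Perron's argument applies to it; using two consecutive powers shows that
  the peripheral eigenvalue of \<open>B\<close> itself is positive, and \<open>B\<close> and \<open>B\<^sup>T\<close> share the signature of
  the same power.
\<close>

text \<open>Multiplicity is the obstacle in the equivalence for a single matrix:
  \<open>simple_eigenvalue\<close> is algebraic, while positivity arguments produce eigenvectors.
  The link is deflation. Subtracting \<open>l / (y \<bullet> x)\<close> times the rank-one matrix of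
  \<open>x\<close> and \<open>y\<close> lowers the order of a nonzero \<open>l\<close> by exactly
  one, and eigenvectors of the result for nonzero eigenvalues are eigenvectors of the original
  matrix. The same splitting gives the asymptotics of the powers without a Jordan form.

  Maximality of a modulus enters Perron's argument only as a growth bound on the powers, a form that
  passes easily to powers, signature conjugates and transposes.

  On the way back from the compounds to \<open>A\<close>, the eigenvalues are at first merely
  complex, hence a complex Schur form sorted by modulus. Moreover, each compound determines the
  signs of its two wedges only up to one global sign depending on \<open>j\<close>, and no
  \<open>j\<close> can be repaired alone, because every vector enters many wedges. Rescaling the
  left eigenvectors by products of two consecutive such signs repairs all \<open>j\<close> at
  once.\<close>

subsection \<open>Increasing index lists\<close>

text \<open>The index sets without their enumeration: sums over minors range over this set, and the
  list \<open>index_sets\<close> is needed only to turn them into matrix coordinates.\<close>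

definition increasing_lists :: "nat \<Rightarrow> nat \<Rightarrow> nat list set" where
  "increasing_lists n j = {K. sorted_wrt (<) K \<and> length K = j \<and> set K \<subseteq> {..<n}}"

lemma combs_Suc_less:
  assumes "a < n"
  shows "combs a n (Suc j) = map (Cons a) (combs (Suc a) n j) @ combs (Suc a) n (Suc j)"
  using assms by (simp add: upt_conv_Cons)

text \<open>Induction on \<open>n - a\<close> along Pascal's recursion: a list over
  \<open>[a..<n]\<close> either begins with \<open>a\<close> or lives over
  \<open>[Suc a..<n]\<close>.\<close>

lemma combs_induct [case_names zero ge step]:
  assumes "\<And>a. P a 0"
    and "\<And>a j. n \<le> a \<Longrightarrow> P a (Suc j)"
    and "\<And>a j. a < n \<Longrightarrow> P (Suc a) j \<Longrightarrow> P (Suc a) (Suc j) \<Longrightarrow> P a (Suc j)"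
  shows "P a j"
proof (induction "n - a" arbitrary: a j rule: less_induct)
  case (less a j)
  show ?case
  proof (cases j)
    case 0
    then show ?thesis using assms(1) by simp
  next
    case (Suc j')
    then show ?thesis using assms(2,3) less
      by (metis diff_less_mono2 lessI linorder_not_less)
  qed
qed

lemma set_combs: "set (combs a n j) = {K. sorted_wrt (<) K \<and> length K = j \<and> set K \<subseteq> {a..<n}}"
proof (induction a j rule: combs_induct[where n = n])
  case (zero a)
  then show ?case by auto
next
  case (ge a j)
  then show ?case by (auto simp: length_Suc_conv)
next
  case (step a j)
  have "K \<in> set (combs a n (Suc j)) \<longleftrightarrow> sorted_wrt (<) K \<and> length K = Suc j \<and> set K \<subseteq> {a..<n}" for K
  proof (cases K)
    case Nil
    then show ?thesis using step by (auto simp: combs_Suc_less simp del: combs.simps)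
  next
    case (Cons k K')
    have "K \<in> set (combs a n (Suc j)) \<longleftrightarrow>
        k = a \<and> K' \<in> set (combs (Suc a) n j) \<or> K \<in> set (combs (Suc a) n (Suc j))"
      unfolding combs_Suc_less[OF step(1)] Cons by auto
    also have "\<dots> \<longleftrightarrow> sorted_wrt (<) K \<and> length K = Suc j \<and> set K \<subseteq> {a..<n}"
      unfolding step(2,3) Cons using step(1)
      by (fastforce simp: Suc_le_eq subset_eq Ball_def)
    finally show ?thesis .
  qed
  then show ?case by blast
qed

lemma set_index_sets: "set (index_sets n j) = increasing_lists n j"
  unfolding index_sets_def set_combs increasing_lists_def by (simp add: atLeast0LessThan)

lemma distinct_combs: "distinct (combs a n j)"
proof (induction a j rule: combs_induct[where n = n])
  case (step a j)
  have "set K \<subseteq> {Suc a..<n}" if "K \<in> set (combs (Suc a) n (Suc j))" for K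
    using that unfolding set_combs by blast
  from this[of "a # K" for K] have "a # K \<notin> set (combs (Suc a) n (Suc j))" for K
    by auto
  then show ?case using step
    by (auto simp: combs_Suc_less distinct_map simp del: combs.simps)
qed auto

lemma distinct_index_sets: "distinct (index_sets n j)"
  unfolding index_sets_def by (rule distinct_combs)

lemma length_combs: "length (combs a n j) = (n - a) choose j"
proof (induction a j rule: combs_induct[where n = n])
  case (step a j)
  have "n - a = Suc (n - Suc a)" using step by simp
  then show ?case using step by (simp add: combs_Suc_less del: combs.simps)
qed auto

lemma length_index_sets [simp]: "length (index_sets n j) = n choose j"
  unfolding index_sets_def by (simp add: length_combs)

text \<open>The one property of the lexicographic order that triangularity of compounds needs: it is
  a linear extension of the entrywise order. In the recursion, the lists without \<open>a\<close>
  come later and have a larger head.\<close>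

lemma sorted_wrt_combs: "sorted_wrt (\<lambda>K L. \<not> list_all2 (\<le>) L K) (combs a n j)"
proof (induction a j rule: combs_induct[where n = n])
  case (step a j)
  have "\<not> list_all2 (\<le>) L (a # K)" if "L \<in> set (combs (Suc a) n (Suc j))" for K L
    using that unfolding set_combs by (cases L) auto
  then show ?case using step
    by (auto simp: combs_Suc_less sorted_wrt_append sorted_wrt_map simp del: combs.simps)
qed auto

lemma index_sets_nth_not_le:
  assumes "b < a" "a < n choose j"
  shows "\<not> list_all2 (\<le>) (index_sets n j ! a) (index_sets n j ! b)"
proof -
  have "a < length (combs 0 n j)" using assms by (simp add: length_combs)
  from sorted_wrt_nth_less[OF sorted_wrt_combs assms(1) this]
  show ?thesis unfolding index_sets_def .
qed

lemma index_sets_nth_in: "a < n choose j \<Longrightarrow> index_sets n j ! a \<in> increasing_lists n j"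
  using nth_mem[of a "index_sets n j"] unfolding set_index_sets by simp

lemma increasing_listsD:
  assumes "K \<in> increasing_lists n j"
  shows "length K = j" "sorted_wrt (<) K" "distinct K" "r < j \<Longrightarrow> K ! r < n"
    "r < s \<Longrightarrow> s < j \<Longrightarrow> K ! r < K ! s"
proof -
  show "distinct K" using assms unfolding increasing_lists_def by (auto simp: strict_sorted_iff)
  show "r < j \<Longrightarrow> K ! r < n" using assms unfolding increasing_lists_def
    using nth_mem by blast
  show "r < s \<Longrightarrow> s < j \<Longrightarrow> K ! r < K ! s" using assms unfolding increasing_lists_def
    using sorted_wrt_nth_less[of "(<)" K r s] by auto
qed (insert assms, auto simp: increasing_lists_def)

lemma sum_increasing_lists:
  "sum f (increasing_lists n j) = (\<Sum>a<n choose j. f (index_sets n j ! a))"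
proof -
  have "bij_betw ((!) (index_sets n j)) {..<n choose j} (increasing_lists n j)"
    using bij_betw_nth[OF distinct_index_sets[of n j] _ set_index_sets[symmetric], of "{..<n choose j}"]
    by simp
  from sum.reindex_bij_betw[OF this, of f] show ?thesis by simp
qed

text \<open>Strictly increasing naturals gain at least one per place. So \<open>[0..<j]\<close> is
  the entrywise least index set, which is why it selects the largest eigenvalues once they are
  sorted.\<close>

lemma increasing_lists_nth_ge:
  assumes "K \<in> increasing_lists n j" "r < j"
  shows "r \<le> K ! r"
  using assms(2)
proof (induction r)
  case (Suc r)
  then have "K ! r < K ! Suc r" using increasing_listsD(5)[OF assms(1), of r "Suc r"] by simp
  then show ?case using Suc by simp
qed simp

lemma upt_in_increasing_lists: "j \<le> n \<Longrightarrow> [0..<j] \<in> increasing_lists n j"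
  unfolding increasing_lists_def by auto

subsection \<open>Minors and the Cauchy--Binet formula\<close>

text \<open>Rectangular \<open>A\<close> is allowed, so that Cauchy--Binet also covers a square
  matrix times the matrix whose columns are the factors of a wedge.\<close>

definition minor :: "'a :: comm_ring_1 mat \<Rightarrow> nat list \<Rightarrow> nat list \<Rightarrow> 'a" where
  "minor A I J = det (mat (length I) (length I) (\<lambda>(r, s). A $$ (I ! r, J ! s)))"

text \<open>The maps that survive when the rows of a product are expanded. Being the identity off
  the first \<open>j\<close> numbers makes each a unique function and matches the convention for
  permutations.\<close>

definition injections :: "nat \<Rightarrow> nat \<Rightarrow> (nat \<Rightarrow> nat) set" where
  "injections n j = {f. (\<forall>i\<in>{0..<j}. f i \<in> {0..<n}) \<and> (\<forall>i. i \<notin> {0..<j} \<longrightarrow> f i = i) \<and> inj_on f {0..<j}}"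

text \<open>An injection is the sorted list of its image together with the permutation that restores
  the order of its values. This splits the Cauchy--Binet sum into index sets and
  permutations.\<close>

lemma bij_betw_injections:
  "bij_betw (\<lambda>(K, p). \<lambda>i. if i < j then K ! p i else i)
     (increasing_lists n j \<times> {p. p permutes {0..<j}}) (injections n j)"
  (is "bij_betw ?g ?S _")
proof -
  have image: "?g (K, p) ` {0..<j} = set K"
    if "K \<in> increasing_lists n j" "p permutes {0..<j}" for K p
  proof -
    have "?g (K, p) ` {0..<j} = (!) K ` (p ` {0..<j})" by (auto simp: image_image)
    also have "\<dots> = (!) K ` {0..<j}" using permutes_image[OF that(2)] by simp
    also have "\<dots> = set K" using increasing_listsD(1)[OF that(1)]
      by (metis list.set_map map_nth set_upt)
    finally show ?thesis .
  qed
  have "inj_on ?g ?S"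
  proof (rule inj_onI, clarify)
    fix K p K' p'
    assume K: "K \<in> increasing_lists n j" and p: "p permutes {0..<j}"
      and K': "K' \<in> increasing_lists n j" and p': "p' permutes {0..<j}"
      and eq: "(\<lambda>i. if i < j then K ! p i else i) = (\<lambda>i. if i < j then K' ! p' i else i)"
    have "set K = set K'" using image[OF K p] image[OF K' p'] eq by simp
    then have KK: "K = K'"
      using increasing_listsD(2)[OF K] increasing_listsD(2)[OF K'] strict_sorted_equal by blast
    have "p i = p' i" for i
    proof (cases "i < j")
      case True
      have "K ! p i = K ! p' i" using fun_cong[OF eq, of i] KK True by simp
      moreover have "p i < j" "p' i < j"
        using permutes_in_image[OF p, of i] permutes_in_image[OF p', of i] True by auto
      ultimately show ?thesis
        using increasing_listsD(1,3)[OF K] by (simp add: nth_eq_iff_index_eq)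
    next
      case False
      then show ?thesis using permutes_not_in[OF p] permutes_not_in[OF p'] by simp
    qed
    then show "K = K' \<and> p = p'" using KK by auto
  qed
  moreover have "f \<in> injections n j" if "f \<in> ?g ` ?S" for f
  proof -
    from that obtain K p where K: "K \<in> increasing_lists n j" and p: "p permutes {0..<j}"
      and f: "f = ?g (K, p)" by auto
    have pj: "p i < j" if "i < j" for i using permutes_in_image[OF p, of i] that by auto
    have "inj_on f {0..<j}"
    proof (rule inj_onI)
      fix i k assume ik: "i \<in> {0..<j}" "k \<in> {0..<j}" "f i = f k"
      then have "p i = p k" using f pj increasing_listsD(1,3)[OF K]
        by (simp add: nth_eq_iff_index_eq)
      then show "i = k" using permutes_inj[OF p] by (meson injD)
    qed
    then show ?thesis
      unfolding injections_def using f pj increasing_listsD(4)[OF K] by auto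
  qed
  moreover have "f \<in> ?g ` ?S" if f: "f \<in> injections n j" for f
  proof -
    define K where "K = sorted_list_of_set (f ` {0..<j})"
    have inj: "inj_on f {0..<j}" using f unfolding injections_def by blast
    have setK: "set K = f ` {0..<j}" unfolding K_def by simp
    have lenK: "length K = j" unfolding K_def using card_image[OF inj] by simp
    have K: "K \<in> increasing_lists n j"
      unfolding increasing_lists_def using f setK lenK
      by (auto simp: K_def injections_def)
    \<comment> \<open>The position of \<open>f i\<close> in the sorted image.\<close>
    define p where "p i = (if i < j then (SOME k. k < j \<and> K ! k = f i) else i)" for i
    have p: "p i < j" "K ! p i = f i" if "i < j" for i
    proof -
      have "f i \<in> set K" using setK that by simp
      then have "\<exists>k. k < j \<and> K ! k = f i" using lenK by (metis in_set_conv_nth)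
      from someI_ex[OF this] show "p i < j" "K ! p i = f i" using that unfolding p_def by auto
    qed
    have "p permutes {0..<j}"
    proof (rule inj_on_nat_permutes)
      show "inj_on p {0..<j}"
      proof (rule inj_onI)
        fix i k assume "i \<in> {0..<j}" "k \<in> {0..<j}" "p i = p k"
        then have "f i = f k" using p(2)[of i] p(2)[of k] by simp
        then show "i = k" using inj \<open>i \<in> _\<close> \<open>k \<in> _\<close> by (meson inj_onD)
      qed
      show "p \<in> {0..<j} \<rightarrow> {0..<j}" using p by auto
    qed (auto simp: p_def)
    moreover have "f = ?g (K, p)"
      using p(2) f by (auto simp: injections_def)
    ultimately show ?thesis using K by blast
  qed
  ultimately show ?thesis unfolding bij_betw_def by blast
qed

text \<open>Cauchy--Binet. Each row of \<open>M * N\<close> is a combination of rows of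
  \<open>N\<close>, so multilinearity turns the determinant into a sum over all choices of rows. A
  choice with a repetition contributes a determinant with two equal rows, and the injective choices
  are grouped by their image \<open>K\<close>.\<close>

lemma minor_mult:
  fixes A B :: "'a :: comm_ring_1 mat"
  assumes A: "A \<in> carrier_mat p n" and B: "B \<in> carrier_mat n q"
    and I: "length I = j" "set I \<subseteq> {..<p}" and J: "length J = j" "set J \<subseteq> {..<q}"
  shows "minor (A * B) I J = (\<Sum>K\<in>increasing_lists n j. minor A I K * minor B K J)"
proof -
  define M where "M = mat j n (\<lambda>(r, k). A $$ (I ! r, k))"
  define N where "N = mat n j (\<lambda>(k, s). B $$ (k, J ! s))"
  have M: "M \<in> carrier_mat j n" and N: "N \<in> carrier_mat n j" unfolding M_def N_def by auto
  have Ip: "I ! r < p" and Jq: "J ! r < q" if "r < j" for r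
    using subsetD[OF I(2) nth_mem[of r I]] subsetD[OF J(2) nth_mem[of r J]] that I(1) J(1) by auto
  let ?U = "{0..<j}"
  let ?F = "{f. (\<forall>i\<in>?U. f i \<in> {0..<n}) \<and> (\<forall>i. i \<notin> ?U \<longrightarrow> f i = i)}"
  let ?h = "\<lambda>f. (\<Prod>i\<in>?U. M $$ (i, f i)) * det (mat\<^sub>r j j (\<lambda>i. row N (f i)))"
  have "minor (A * B) I J = det (M * N)"
    unfolding minor_def
    by (rule arg_cong[where f = det], rule eq_matI)
       (insert A B I J Ip Jq, auto simp: M_def N_def scalar_prod_def)
  also have "\<dots> = (\<Sum>f\<in>?F. det (mat\<^sub>r j j (\<lambda>i. M $$ (i, f i) \<cdot>\<^sub>v row N (f i))))"
    unfolding mat_mul_finsum_alt[OF M N]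
    by (rule det_linear_rows_sum) (insert N, auto)
  also have "\<dots> = sum ?h ?F"
    by (rule sum.cong[OF refl], rule det_rows_mul) (insert N, auto)
  also have "\<dots> = sum ?h (injections n j)"
  proof (rule sum.mono_neutral_right)
    show "finite ?F" by (rule finite_bounded_functions) auto
    show "injections n j \<subseteq> ?F" unfolding injections_def by auto
    show "\<forall>f\<in>?F - injections n j. ?h f = 0"
    proof
      fix f assume "f \<in> ?F - injections n j"
      then have "\<not> inj_on f ?U" unfolding injections_def by blast
      then obtain i k where ik: "i \<noteq> k" "i < j" "k < j" "f i = f k"
        unfolding inj_on_def by auto
      have "det (mat\<^sub>r j j (\<lambda>i. row N (f i))) = 0"
        by (rule det_identical_rows[OF _ ik(1-3)]) (insert ik N, auto)
      then show "?h f = 0" by simp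
    qed
  qed
  also have "\<dots> = (\<Sum>(K, p)\<in>increasing_lists n j \<times> {p. p permutes ?U}.
      ?h (\<lambda>i. if i < j then K ! p i else i))"
    unfolding sum.reindex_bij_betw[OF bij_betw_injections, of ?h, symmetric]
    by (rule sum.cong) auto
  also have "\<dots> = (\<Sum>K\<in>increasing_lists n j. \<Sum>p\<in>{p. p permutes ?U}.
      ?h (\<lambda>i. if i < j then K ! p i else i))"
    by (rule sum.cartesian_product[symmetric])
  also have "\<dots> = (\<Sum>K\<in>increasing_lists n j. minor A I K * minor B K J)"
  proof (rule sum.cong[OF refl])
    fix K assume K: "K \<in> increasing_lists n j"
    note KD = increasing_listsD[OF K]
    let ?C = "mat j j (\<lambda>(r, s). A $$ (I ! r, K ! s))"
    let ?D = "mat j j (\<lambda>(r, s). B $$ (K ! r, J ! s))"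
    \<comment> \<open>The chosen rows of \<open>N\<close> are the rows of \<open>?D\<close> permuted
      by \<open>p\<close>, which costs the sign of \<open>p\<close>. What remains is the Leibniz
      term of \<open>?C\<close> for \<open>p\<close>.\<close>
    have "?h (\<lambda>i. if i < j then K ! p i else i)
        = (signof p * (\<Prod>i\<in>?U. ?C $$ (i, p i))) * det ?D" if "p permutes ?U" for p
    proof -
      have pj: "p i < j" if "i < j" for i using permutes_in_image[OF \<open>p permutes ?U\<close>, of i] that by auto
      have "mat\<^sub>r j j (\<lambda>i. row N (if i < j then K ! p i else i)) = mat j j (\<lambda>(i, s). ?D $$ (p i, s))"
        by (rule eq_matI) (insert N KD pj, auto simp: N_def)
      then have 1: "det (mat\<^sub>r j j (\<lambda>i. row N (if i < j then K ! p i else i))) = signof p * det ?D"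
        using det_permute_rows[of ?D j p] that by simp
      have 2: "(\<Prod>i\<in>?U. M $$ (i, if i < j then K ! p i else i)) = (\<Prod>i\<in>?U. ?C $$ (i, p i))"
        by (rule prod.cong) (insert KD pj, auto simp: M_def)
      show ?thesis unfolding 1 2 by (simp add: ac_simps)
    qed
    then have "(\<Sum>p\<in>{p. p permutes ?U}. ?h (\<lambda>i. if i < j then K ! p i else i))
        = (\<Sum>p\<in>{p. p permutes ?U}. signof p * (\<Prod>i\<in>?U. ?C $$ (i, p i))) * det ?D"
      unfolding sum_distrib_right by (intro sum.cong) auto
    also have "\<dots> = det ?C * det ?D" by (subst det_def'[of ?C j]) auto
    also have "\<dots> = minor A I K * minor B K J" unfolding minor_def using I KD by simp
    finally show "(\<Sum>p\<in>{p. p permutes ?U}. ?h (\<lambda>i. if i < j then K ! p i else i))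
        = minor A I K * minor B K J" .
  qed
  finally show ?thesis .
qed

lemma minor_transpose:
  assumes A: "A \<in> carrier_mat n m" and I: "I \<in> increasing_lists m j" and J: "J \<in> increasing_lists n j"
  shows "minor (transpose_mat A) I J = minor A J I"
proof -
  note D = increasing_listsD[OF I] increasing_listsD[OF J]
  have "mat j j (\<lambda>(r, s). transpose_mat A $$ (I ! r, J ! s))
      = transpose_mat (mat j j (\<lambda>(r, s). A $$ (J ! r, I ! s)))"
    by (rule eq_matI) (insert A D, auto)
  then show ?thesis unfolding minor_def using D det_transpose[of "mat j j (\<lambda>(r, s). A $$ (J ! r, I ! s))" j]
    by simp
qed

text \<open>Every Leibniz term contains an entry below the diagonal. Take \<open>q\<close> with
  \<open>J ! q < I ! q\<close>: some row \<open>r\<close> at or after \<open>q\<close> is sent to a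
  column at or before \<open>q\<close>, and there
  \<open>J ! p r \<le> J ! q < I ! q \<le> I ! r\<close>.\<close>

lemma minor_upper_triangular_eq_0:
  assumes T: "T \<in> carrier_mat n n" "upper_triangular T"
    and I: "I \<in> increasing_lists n j" and J: "J \<in> increasing_lists n j"
    and nle: "\<not> list_all2 (\<le>) I J"
  shows "minor T I J = 0"
proof -
  note ID = increasing_listsD[OF I] and JD = increasing_listsD[OF J]
  obtain q where q: "q < j" "J ! q < I ! q"
    using nle ID JD by (auto simp: list_all2_conv_all_nth not_le)
  let ?C = "mat j j (\<lambda>(r, s). T $$ (I ! r, J ! s))"
  have "signof p * (\<Prod>i = 0..<j. ?C $$ (i, p i)) = 0" if p: "p permutes {0..<j}" for p
  proof -
    \<comment> \<open>Pigeonhole: \<open>{q..<j}\<close> cannot be mapped injectively into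
      \<open>{Suc q..<j}\<close>.\<close>
    have "\<exists>r\<in>{q..<j}. p r \<le> q"
    proof (rule ccontr)
      assume "\<not> ?thesis"
      then have "p ` {q..<j} \<subseteq> {Suc q..<j}" using permutes_in_image[OF p] by force
      then have "card (p ` {q..<j}) \<le> card {Suc q..<j}" by (intro card_mono) auto
      moreover have "card (p ` {q..<j}) = card {q..<j}"
        by (rule card_image) (rule permutes_inj_on[OF p])
      ultimately show False using q by simp
    qed
    then obtain r where r: "q \<le> r" "r < j" "p r \<le> q" by auto
    have "J ! p r \<le> J ! q" using JD(5)[of "p r" q] r q by (cases "p r = q") auto
    also have "\<dots> < I ! q" by (rule q)
    also have "\<dots> \<le> I ! r" using ID(5)[of q r] r by (cases "q = r") auto
    finally have "T $$ (I ! r, J ! p r) = 0"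
      using T ID(4)[of r] r by (auto dest: upper_triangularD)
    then have "?C $$ (r, p r) = 0" using r q by auto
    then have "(\<Prod>i = 0..<j. ?C $$ (i, p i)) = 0"
      using r by (intro prod_zero bexI[of _ r]) (simp_all only: finite_atLeastLessThan atLeastLessThan_iff, simp)
    then show ?thesis by simp
  qed
  then have "det ?C = 0" by (subst det_def'[of _ j]) auto
  then show ?thesis unfolding minor_def using ID by simp
qed

lemma minor_upper_triangular_diag:
  assumes T: "T \<in> carrier_mat n n" "upper_triangular T" and I: "I \<in> increasing_lists n j"
  shows "minor T I I = (\<Prod>i\<leftarrow>I. T $$ (i, i))"
proof -
  note ID = increasing_listsD[OF I]
  let ?C = "mat j j (\<lambda>(r, s). T $$ (I ! r, I ! s))"
  have "upper_triangular ?C"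
    unfolding upper_triangular_def using T ID by (auto dest: upper_triangularD)
  then have "det ?C = prod_list (diag_mat ?C)"
    by (rule det_upper_triangular[of _ j]) simp
  also have "diag_mat ?C = map (\<lambda>i. T $$ (i, i)) I"
    by (rule nth_equalityI) (insert ID, auto simp: diag_mat_def)
  finally show ?thesis unfolding minor_def using ID by simp
qed

subsection \<open>Compound matrices over a commutative ring\<close>

text \<open>The notion \<open>compound\<close> over any commutative ring, because the real matrix
  has to be compared with a complex triangular form.\<close>

definition compound_mat :: "'a :: comm_ring_1 mat \<Rightarrow> nat \<Rightarrow> 'a mat" where
  "compound_mat A j = mat (dim_row A choose j) (dim_row A choose j)
     (\<lambda>(a, b). minor A (index_sets (dim_row A) j ! a) (index_sets (dim_row A) j ! b))"

lemma compound_mat_carrier [simp]: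
  "A \<in> carrier_mat n n \<Longrightarrow> compound_mat A j \<in> carrier_mat (n choose j) (n choose j)"
  unfolding compound_mat_def by auto

lemma compound_mat_index:
  "A \<in> carrier_mat n n \<Longrightarrow> a < n choose j \<Longrightarrow> b < n choose j \<Longrightarrow>
    compound_mat A j $$ (a, b) = minor A (index_sets n j ! a) (index_sets n j ! b)"
  unfolding compound_mat_def by auto

lemma compound_eq_compound_mat:
  assumes "A \<in> carrier_mat n n"
  shows "compound A j = compound_mat A j"
  by (rule eq_matI)
     (insert assms increasing_listsD(1)[OF index_sets_nth_in], auto simp: compound_def compound_mat_def minor_def Let_def)

lemma compound_mat_mult:
  fixes A B :: "'a :: comm_ring_1 mat"
  assumes A: "A \<in> carrier_mat n n" and B: "B \<in> carrier_mat n n"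
  shows "compound_mat (A * B) j = compound_mat A j * compound_mat B j"
proof (rule eq_matI)
  let ?I = "index_sets n j"
  fix a b assume "a < dim_row (compound_mat A j * compound_mat B j)"
    "b < dim_col (compound_mat A j * compound_mat B j)"
  then have ab: "a < n choose j" "b < n choose j"
    using carrier_matD[OF compound_mat_carrier[OF A]] carrier_matD[OF compound_mat_carrier[OF B]] by auto
  have in': "length (?I ! a) = j" "set (?I ! a) \<subseteq> {..<n}" if "a < n choose j" for a
    using index_sets_nth_in[OF that] unfolding increasing_lists_def by auto
  have "compound_mat (A * B) j $$ (a, b) = minor (A * B) (?I ! a) (?I ! b)"
    using compound_mat_index[of "A * B" n a j b] A B ab by simp
  also have "\<dots> = (\<Sum>K\<in>increasing_lists n j. minor A (?I ! a) K * minor B K (?I ! b))"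
    by (rule minor_mult[OF A B]) (insert in' ab, auto)
  also have "\<dots> = (\<Sum>c<n choose j. minor A (?I ! a) (?I ! c) * minor B (?I ! c) (?I ! b))"
    by (rule sum_increasing_lists)
  also have "\<dots> = (compound_mat A j * compound_mat B j) $$ (a, b)"
    using ab A B carrier_matD[OF compound_mat_carrier[OF A, of j]] carrier_matD[OF compound_mat_carrier[OF B, of j]]
    by (auto simp: scalar_prod_def compound_mat_index atLeast0LessThan intro!: sum.cong)
  finally show "compound_mat (A * B) j $$ (a, b) = (compound_mat A j * compound_mat B j) $$ (a, b)" .
qed (insert A B, auto simp: compound_mat_def)

lemma compound_mat_transpose:
  assumes "A \<in> carrier_mat n n"
  shows "compound_mat (transpose_mat A) j = transpose_mat (compound_mat A j)"
  by (rule eq_matI)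
     (insert assms, auto simp: compound_mat_def intro!: minor_transpose index_sets_nth_in)

text \<open>Here the lexicographic enumeration matters: below the diagonal the row index set comes
  later than the column index set, hence is not entrywise below it, and such a minor of a triangular
  matrix vanishes.\<close>

lemma upper_triangular_compound_mat:
  assumes "T \<in> carrier_mat n n" "upper_triangular T"
  shows "upper_triangular (compound_mat T j)"
  unfolding upper_triangular_def
  using assms carrier_matD[OF compound_mat_carrier[OF assms(1), of j]]
  by (auto simp: compound_mat_index index_sets_nth_not_le intro!: minor_upper_triangular_eq_0 index_sets_nth_in)

lemma diag_mat_compound_mat:
  assumes "T \<in> carrier_mat n n" "upper_triangular T"
  shows "diag_mat (compound_mat T j) = map (\<lambda>I. \<Prod>i\<leftarrow>I. T $$ (i, i)) (index_sets n j)"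
  by (rule nth_equalityI)
     (insert assms carrier_matD[OF compound_mat_carrier[OF assms(1), of j]],
       auto simp: diag_mat_def compound_mat_index intro!: minor_upper_triangular_diag index_sets_nth_in)

text \<open>Off-diagonal minors need no computation: the compound is upper triangular because the
  identity is, and it is symmetric because the identity is.\<close>

lemma compound_mat_one: "compound_mat (1\<^sub>m n) j = 1\<^sub>m (n choose j)"
proof (rule eq_matI)
  let ?C = "compound_mat (1\<^sub>m n :: 'a mat) j"
  have T: "upper_triangular (1\<^sub>m n :: 'a mat)" by auto
  have C: "?C \<in> carrier_mat (n choose j) (n choose j)" by simp
  fix a b assume "a < dim_row (1\<^sub>m (n choose j) :: 'a mat)" "b < dim_col (1\<^sub>m (n choose j) :: 'a mat)"
  then have ab: "a < n choose j" "b < n choose j" by auto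
  have low: "?C $$ (a, b) = 0" if "b < a" "a < n choose j" for a b
    using upper_triangularD[OF upper_triangular_compound_mat[OF one_carrier_mat T, of j] that(1)] that C
    by auto
  consider "b < a" | "a < b" | "a = b" by linarith
  then show "?C $$ (a, b) = 1\<^sub>m (n choose j) $$ (a, b)"
  proof cases
    case 1
    then show ?thesis using low ab by simp
  next
    case 2
    have "transpose_mat ?C = ?C"
      using compound_mat_transpose[of "1\<^sub>m n :: 'a mat" n j] by simp
    then have "?C $$ (a, b) = ?C $$ (b, a)"
      using ab C by (metis carrier_matD index_transpose_mat(1))
    then show ?thesis using low 2 ab by simp
  next
    case 3
    have K: "index_sets n j ! a \<in> increasing_lists n j" using ab by (simp add: index_sets_nth_in)
    have "?C $$ (a, a) = (\<Prod>i\<leftarrow>index_sets n j ! a. (1\<^sub>m n :: 'a mat) $$ (i, i))"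
      by (rule trans[OF compound_mat_index[OF one_carrier_mat ab(1) ab(1)]
            minor_upper_triangular_diag[OF one_carrier_mat T K]])
    also have "\<dots> = (\<Prod>i\<leftarrow>index_sets n j ! a. 1)"
      using K by (intro arg_cong[where f = prod_list] map_cong) (auto simp: increasing_lists_def)
    also have "(\<Prod>i\<leftarrow>K. 1) = (1 :: 'a)" for K :: "nat list" by (induction K) auto
    finally show ?thesis using 3 ab by simp
  qed
qed (simp_all add: compound_mat_def)

lemma compound_mat_pow:
  fixes A :: "'a :: comm_ring_1 mat"
  assumes A: "A \<in> carrier_mat n n"
  shows "compound_mat (A ^\<^sub>m k) j = compound_mat A j ^\<^sub>m k"
proof (induction k)
  case 0
  then show ?case using A compound_mat_one[of n j] carrier_matD[OF compound_mat_carrier[OF A, of j]] by simp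
next
  case (Suc k)
  then show ?case using compound_mat_mult[OF pow_carrier_mat[OF A] A] by simp
qed

lemma similar_compound_mat:
  fixes A B :: "'a :: comm_ring_1 mat"
  assumes A: "A \<in> carrier_mat n n" and "similar_mat A B"
  shows "similar_mat (compound_mat A j) (compound_mat B j)"
proof -
  from assms(2) obtain P Q where PQ: "similar_mat_wit A B P Q" unfolding similar_mat_def by auto
  note D = similar_mat_witD2[OF A PQ]
  have "similar_mat_wit (compound_mat A j) (compound_mat B j) (compound_mat P j) (compound_mat Q j)"
  proof (rule similar_mat_witI)
    show "compound_mat P j * compound_mat Q j = 1\<^sub>m (n choose j)"
      using compound_mat_mult[OF D(6,7)] D(1) by (simp add: compound_mat_one)
    show "compound_mat Q j * compound_mat P j = 1\<^sub>m (n choose j)"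
      using compound_mat_mult[OF D(7,6)] D(2) by (simp add: compound_mat_one)
    show "compound_mat A j = compound_mat P j * compound_mat B j * compound_mat Q j"
      using compound_mat_mult[of "P * B" n Q j] compound_mat_mult[of P n B j] D by simp
  qed (insert D, auto)
  then show ?thesis unfolding similar_mat_def by blast
qed

lemma char_poly_compound_mat:
  fixes A T :: "'a :: comm_ring_1 mat"
  assumes A: "A \<in> carrier_mat n n" and "similar_mat A T" and ut: "upper_triangular T"
  shows "char_poly (compound_mat A j) = (\<Prod>I\<leftarrow>index_sets n j. [:- (\<Prod>i\<leftarrow>I. T $$ (i, i)), 1:])"
proof -
  have T: "T \<in> carrier_mat n n" using similar_matD[OF assms(2)] A by auto
  have "char_poly (compound_mat A j) = char_poly (compound_mat T j)"
    by (rule char_poly_similar[OF similar_compound_mat[OF A assms(2)]])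
  also have "\<dots> = (\<Prod>a\<leftarrow>diag_mat (compound_mat T j). [:- a, 1:])"
    by (rule char_poly_upper_triangular[OF compound_mat_carrier[OF T] upper_triangular_compound_mat[OF T ut]])
  finally show ?thesis unfolding diag_mat_compound_mat[OF T ut] by (simp add: comp_def)
qed

lemma (in comm_ring_hom) compound_mat_hom:
  assumes "A \<in> carrier_mat n n"
  shows "compound_mat (mat\<^sub>h A) j = mat\<^sub>h (compound_mat A j)"
proof (rule eq_matI)
  fix a b assume "a < dim_row (mat\<^sub>h (compound_mat A j))" "b < dim_col (mat\<^sub>h (compound_mat A j))"
  then have ab: "a < n choose j" "b < n choose j" using assms by (auto simp: compound_mat_def)
  note D = increasing_listsD[OF index_sets_nth_in[OF ab(1)]] increasing_listsD[OF index_sets_nth_in[OF ab(2)]]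
  have "mat j j (\<lambda>(r, s). mat\<^sub>h A $$ (index_sets n j ! a ! r, index_sets n j ! b ! s))
      = mat\<^sub>h (mat j j (\<lambda>(r, s). A $$ (index_sets n j ! a ! r, index_sets n j ! b ! s)))"
    by (rule eq_matI) (insert assms D, auto)
  then show "compound_mat (mat\<^sub>h A) j $$ (a, b) = mat\<^sub>h (compound_mat A j) $$ (a, b)"
    using assms ab D by (simp add: compound_mat_def minor_def hom_det)
qed (insert assms, auto simp: compound_mat_def)

subsection \<open>Deflation of an eigenvalue\<close>

definition outer_prod :: "'a :: times vec \<Rightarrow> 'a vec \<Rightarrow> 'a mat" where
  "outer_prod x y = mat (dim_vec x) (dim_vec y) (\<lambda>(i, j). x $ i * y $ j)"

lemma outer_prod_carrier [simp]:
  "x \<in> carrier_vec m \<Longrightarrow> y \<in> carrier_vec n \<Longrightarrow> outer_prod x y \<in> carrier_mat m n"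
  unfolding outer_prod_def by auto

lemma mult_mat_vec_index_sum:
  "A \<in> carrier_mat m n \<Longrightarrow> v \<in> carrier_vec n \<Longrightarrow> i < m \<Longrightarrow>
    (A *\<^sub>v v) $ i = (\<Sum>j<n. A $$ (i, j) * v $ j)"
  by (auto simp: scalar_prod_def lessThan_atLeast0 intro!: sum.cong)

lemma scalar_prod_mult_mat_vec:
  fixes B :: "'a :: comm_semiring_0 mat"
  assumes B: "B \<in> carrier_mat m n" and y: "y \<in> carrier_vec m" and v: "v \<in> carrier_vec n"
  shows "y \<bullet> (B *\<^sub>v v) = (transpose_mat B *\<^sub>v y) \<bullet> v"
proof -
  have "y \<bullet> (B *\<^sub>v v) = (\<Sum>i<m. \<Sum>j<n. y $ i * (B $$ (i, j) * v $ j))"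
    using assms by (auto simp: scalar_prod_def lessThan_atLeast0 sum_distrib_left intro!: sum.cong)
  also have "\<dots> = (\<Sum>j<n. \<Sum>i<m. y $ i * (B $$ (i, j) * v $ j))" by (rule sum.swap)
  also have "\<dots> = (transpose_mat B *\<^sub>v y) \<bullet> v"
    using assms
    by (auto simp: scalar_prod_def lessThan_atLeast0 sum_distrib_right sum_distrib_left ac_simps intro!: sum.cong)
  finally show ?thesis .
qed

lemma outer_prod_mult_vec:
  fixes x y :: "'a :: comm_semiring_0 vec"
  assumes "x \<in> carrier_vec m" "y \<in> carrier_vec n" "v \<in> carrier_vec n"
  shows "outer_prod x y *\<^sub>v v = (y \<bullet> v) \<cdot>\<^sub>v x"
  by (rule eq_vecI)
     (insert assms, auto simp: outer_prod_def scalar_prod_def sum_distrib_right sum_distrib_left ac_simps intro!: sum.cong)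

lemma mult_outer_prod:
  fixes M :: "'a :: comm_semiring_0 mat"
  assumes "M \<in> carrier_mat k m" "x \<in> carrier_vec m" "y \<in> carrier_vec n"
  shows "M * outer_prod x y = outer_prod (M *\<^sub>v x) y"
  by (rule eq_matI)
     (insert assms, auto simp: outer_prod_def scalar_prod_def sum_distrib_right sum_distrib_left ac_simps intro!: sum.cong)

lemma outer_prod_mult:
  fixes M :: "'a :: comm_semiring_0 mat"
  assumes "M \<in> carrier_mat n k" "x \<in> carrier_vec m" "y \<in> carrier_vec n"
  shows "outer_prod x y * M = outer_prod x (transpose_mat M *\<^sub>v y)"
  by (rule eq_matI)
     (insert assms, auto simp: outer_prod_def scalar_prod_def sum_distrib_left ac_simps intro!: sum.cong)

lemma outer_prod_smult:
  fixes x y :: "'a :: comm_semiring_0 vec"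
  shows "outer_prod (a \<cdot>\<^sub>v x) y = a \<cdot>\<^sub>m outer_prod x y" "outer_prod x (a \<cdot>\<^sub>v y) = a \<cdot>\<^sub>m outer_prod x y"
  by (auto simp: outer_prod_def ac_simps)

text \<open>The matrix determinant lemma. The bordered matrix with blocks \<open>1\<close>,
  \<open>R\<close>, \<open>S\<close>, \<open>1\<close> factors as \<open>?L * ?U\<close> and as
  \<open>?V * ?L\<close> with the same unipotent \<open>?L\<close>; the two Schur complements
  therefore have equal determinants.\<close>

lemma det_one_minus_outer_prod:
  fixes x y :: "'a :: idom vec"
  assumes x: "x \<in> carrier_vec m" and y: "y \<in> carrier_vec m"
  shows "det (1\<^sub>m m - outer_prod x y) = 1 - y \<bullet> x"
proof -
  define R where "R = mat 1 m (\<lambda>(i, j). y $ j)"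
  define S where "S = mat m 1 (\<lambda>(i, j). x $ i)"
  define E where "E = mat 1 1 (\<lambda>_. 1 - y \<bullet> x)"
  let ?L = "four_block_mat (1\<^sub>m 1) (0\<^sub>m 1 m) S (1\<^sub>m m)"
  let ?U = "four_block_mat (1\<^sub>m 1) R (0\<^sub>m m 1) (1\<^sub>m m - outer_prod x y)"
  let ?V = "four_block_mat E R (0\<^sub>m m 1) (1\<^sub>m m)"
  have car: "R \<in> carrier_mat 1 m" "S \<in> carrier_mat m 1" "E \<in> carrier_mat 1 1"
    "outer_prod x y \<in> carrier_mat m m"
    unfolding R_def S_def E_def using x y by auto
  have SR: "S * R = outer_prod x y"
    by (rule eq_matI) (insert x y, auto simp: S_def R_def outer_prod_def scalar_prod_def)
  have RS: "E + R * S = 1\<^sub>m 1"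
    by (rule eq_matI) (insert x y, auto simp: S_def R_def E_def scalar_prod_def)
  have sum: "outer_prod x y + (1\<^sub>m m - outer_prod x y) = 1\<^sub>m m"
    by (rule eq_matI) (insert car, auto)
  have car2: "?L \<in> carrier_mat (1 + m) (1 + m)" "?U \<in> carrier_mat (1 + m) (1 + m)"
    "?V \<in> carrier_mat (1 + m) (1 + m)"
    using car by auto
  have "?L * ?U = four_block_mat (1\<^sub>m 1) R S (1\<^sub>m m)"
    by (subst mult_four_block_mat[where ?nr1.0 = 1 and ?n1.0 = 1 and ?n2.0 = m and ?nr2.0 = m and ?nc1.0 = 1 and ?nc2.0 = m])
       (insert car, auto simp: SR sum)
  moreover have "?V * ?L = four_block_mat (1\<^sub>m 1) R S (1\<^sub>m m)"
    by (subst mult_four_block_mat[where ?nr1.0 = 1 and ?n1.0 = 1 and ?n2.0 = m and ?nr2.0 = m and ?nc1.0 = 1 and ?nc2.0 = m])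
       (insert car, auto simp: RS)
  ultimately have "det ?L * det ?U = det ?V * det ?L"
    using det_mult[OF car2(1,2)] det_mult[OF car2(3,1)] by simp
  moreover have "det ?L = 1"
    by (subst det_four_block_mat_upper_right_zero[where n = 1 and m = m]) (insert car, auto)
  moreover have "det ?U = det (1\<^sub>m m - outer_prod x y)"
    by (subst det_four_block_mat_lower_left_zero_col[where n = m]) (insert car, auto)
  moreover have "det ?V = 1 - y \<bullet> x"
    by (subst det_four_block_mat_lower_left_zero_col[where n = m]) (insert car, auto simp: det_single E_def)
  ultimately show ?thesis by simp
qed

text \<open>Hotelling's deflation. If \<open>x\<close> and \<open>y\<close> are right and left
  eigenvectors for \<open>l\<close>, it sends \<open>x\<close> to zero and acts like
  \<open>B\<close> on the vectors annihilated by \<open>y\<close>.\<close>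

definition deflate :: "'a :: field mat \<Rightarrow> 'a \<Rightarrow> 'a vec \<Rightarrow> 'a vec \<Rightarrow> 'a mat" where
  "deflate B l x y = B - (l / (y \<bullet> x)) \<cdot>\<^sub>m outer_prod x y"

lemma deflate_carrier [simp]:
  "B \<in> carrier_mat m m \<Longrightarrow> x \<in> carrier_vec m \<Longrightarrow> y \<in> carrier_vec m \<Longrightarrow> deflate B l x y \<in> carrier_mat m m"
  unfolding deflate_def by (intro minus_carrier_mat) auto

lemma deflate_mult_vec:
  assumes "B \<in> carrier_mat m m" "x \<in> carrier_vec m" "y \<in> carrier_vec m" "v \<in> carrier_vec m"
  shows "deflate B l x y *\<^sub>v v = B *\<^sub>v v - (l / (y \<bullet> x) * (y \<bullet> v)) \<cdot>\<^sub>v x"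
proof -
  have "deflate B l x y *\<^sub>v v = B *\<^sub>v v - ((l / (y \<bullet> x)) \<cdot>\<^sub>m outer_prod x y) *\<^sub>v v"
    unfolding deflate_def using assms by (intro minus_mult_distrib_mat_vec) auto
  also have "((l / (y \<bullet> x)) \<cdot>\<^sub>m outer_prod x y) *\<^sub>v v = (l / (y \<bullet> x)) \<cdot>\<^sub>v (outer_prod x y *\<^sub>v v)"
    by (rule eq_vecI) (insert assms, auto simp: outer_prod_def)
  finally show ?thesis using assms by (simp add: outer_prod_mult_vec smult_smult_assoc)
qed

text \<open>Since \<open>?C\<close> kills \<open>x\<close>, the matrix \<open>z - B\<close> is
  \<open>z - ?C\<close> times an identity minus a rank-one matrix, whose determinant is
  \<open>1 - l / z\<close>. Thus \<open>z\<close> times one characteristic polynomial is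
  \<open>z - l\<close> times the other, and at the nonzero \<open>l\<close> the orders differ by
  one.\<close>

lemma order_char_poly_deflate:
  fixes B :: "'a :: field_char_0 mat"
  assumes B: "B \<in> carrier_mat m m" and x: "x \<in> carrier_vec m" and y: "y \<in> carrier_vec m"
    and Bx: "B *\<^sub>v x = l \<cdot>\<^sub>v x" and yx: "y \<bullet> x \<noteq> 0" and l: "l \<noteq> 0"
  shows "order l (char_poly B) = Suc (order l (char_poly (deflate B l x y)))"
proof -
  let ?C = "deflate B l x y"
  have C: "?C \<in> carrier_mat m m" using B x y by simp
  have Cx: "?C *\<^sub>v x = 0\<^sub>v m"
    unfolding deflate_mult_vec[OF B x y x] Bx using yx x by (intro eq_vecI) auto
  have pointwise: "z * poly (char_poly B) z = (z - l) * poly (char_poly ?C) z" if z: "z \<noteq> 0" for z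
  proof -
    let ?M = "- char_matrix ?C z"
    let ?c = "l / (y \<bullet> x) / z"
    have M: "?M \<in> carrier_mat m m" using C by simp
    have Mx: "?M *\<^sub>v x = z \<cdot>\<^sub>v x"
    proof (rule eq_vecI)
      fix i assume "i < dim_vec (z \<cdot>\<^sub>v x)"
      then have i: "i < m" using x by simp
      have "(?M *\<^sub>v x) $ i = (\<Sum>j<m. (if i = j then z else 0) * x $ j - ?C $$ (i, j) * x $ j)"
        unfolding mult_mat_vec_index_sum[OF M x i]
        by (rule sum.cong) (insert C i, auto simp: char_matrix_def algebra_simps)
      also have "\<dots> = z * x $ i - (?C *\<^sub>v x) $ i"
        unfolding sum_subtractf mult_mat_vec_index_sum[OF C x i]
        using i by (auto simp: if_distrib[of "\<lambda>c. c * _"] cong: if_cong)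
      finally show "(?M *\<^sub>v x) $ i = (z \<cdot>\<^sub>v x) $ i" using Cx i x by simp
    qed (insert C x, auto simp: char_matrix_def)
    have "?M * (1\<^sub>m m - outer_prod (?c \<cdot>\<^sub>v x) y) = ?M - ?M * outer_prod (?c \<cdot>\<^sub>v x) y"
      using mult_minus_distrib_mat[OF M one_carrier_mat, of "outer_prod (?c \<cdot>\<^sub>v x) y"] M x y by simp
    also have "?M * outer_prod (?c \<cdot>\<^sub>v x) y = (l / (y \<bullet> x)) \<cdot>\<^sub>m outer_prod x y"
    proof -
      have "?M * outer_prod (?c \<cdot>\<^sub>v x) y = outer_prod (?c \<cdot>\<^sub>v (z \<cdot>\<^sub>v x)) y"
        using x y by (subst mult_outer_prod[OF M]) (auto simp: mult_mat_vec[OF M x] Mx)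
      then show ?thesis using z by (simp add: outer_prod_smult smult_smult_assoc)
    qed
    also have "?M - (l / (y \<bullet> x)) \<cdot>\<^sub>m outer_prod x y = - char_matrix B z"
      by (rule eq_matI) (insert B C x y, auto simp: char_matrix_def deflate_def outer_prod_def)
    finally have "det (- char_matrix B z) = det ?M * det (1\<^sub>m m - outer_prod (?c \<cdot>\<^sub>v x) y)"
      using det_mult[OF M minus_carrier_mat[OF outer_prod_carrier], of "?c \<cdot>\<^sub>v x" y "1\<^sub>m m"] x y by simp
    also have "det (1\<^sub>m m - outer_prod (?c \<cdot>\<^sub>v x) y) = 1 - l / z"
      using yx x y by (subst det_one_minus_outer_prod) auto
    finally show ?thesis
      unfolding char_poly_matrix[OF B] char_poly_matrix[OF C] using z by (simp add: field_simps)
  qed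
  \<comment> \<open>The pointwise identity is known only for nonzero \<open>z\<close>. One further
    factor \<open>[:0, 1:]\<close> on both sides makes it hold at zero too, so that equal polynomial
    functions give equal polynomials; the factor is then cancelled.\<close>
  have "poly ([:0, 1:] * ([:0, 1:] * char_poly B)) = poly ([:0, 1:] * ([:-l, 1:] * char_poly ?C))"
  proof
    fix z show "poly ([:0, 1:] * ([:0, 1:] * char_poly B)) z = poly ([:0, 1:] * ([:-l, 1:] * char_poly ?C)) z"
      using arg_cong[OF pointwise[of z], of "(*) z"] by (cases "z = 0") (auto simp: algebra_simps)
  qed
  then have "[:0, 1:] * ([:0, 1:] * char_poly B) = [:0, 1:] * ([:-l, 1:] * char_poly ?C)"
    by (simp only: poly_eq_poly_eq_iff)
  then have eq: "[:0, 1:] * char_poly B = [:-l, 1:] * char_poly ?C"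
    by (metis mult_left_cancel pCons_eq_0_iff zero_neq_one)
  have nz: "char_poly B \<noteq> 0" "char_poly ?C \<noteq> 0"
    using degree_monic_char_poly[OF B] degree_monic_char_poly[OF C] by auto
  have "order l ([:0, 1:] * char_poly B) = order l (char_poly B)"
    using nz l by (subst order_mult) (auto simp: order_linear')
  moreover have "order l ([:-l, 1:] * char_poly ?C) = Suc (order l (char_poly ?C))"
    using nz by (subst order_mult) (auto simp: order_linear' simp del: mult_pCons_left)
  ultimately show ?thesis using eq by simp
qed

text \<open>Trades a multiplicity for the absence of an eigenvector, which positivity arguments can
  refute directly.\<close>

lemma order_eq_1_iff_deflate:
  fixes B :: "'a :: field_char_0 mat"
  assumes "B \<in> carrier_mat m m" "x \<in> carrier_vec m" "y \<in> carrier_vec m"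
    and "B *\<^sub>v x = l \<cdot>\<^sub>v x" "y \<bullet> x \<noteq> 0" "l \<noteq> 0"
  shows "order l (char_poly B) = 1 \<longleftrightarrow> \<not> eigenvalue (deflate B l x y) l"
proof -
  have C: "deflate B l x y \<in> carrier_mat m m" using assms by simp
  have "char_poly (deflate B l x y) \<noteq> 0" using degree_monic_char_poly[OF C] by auto
  then show ?thesis
    unfolding order_char_poly_deflate[OF assms] eigenvalue_root_char_poly[OF C]
    by (simp add: order_eq_0_iff)
qed

lemma deflate_orthogonal:
  assumes B: "B \<in> carrier_mat m m" and x: "x \<in> carrier_vec m" and y: "y \<in> carrier_vec m"
    and v: "v \<in> carrier_vec m"
    and By: "transpose_mat B *\<^sub>v y = l \<cdot>\<^sub>v y" and yx: "y \<bullet> x \<noteq> 0"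
  shows "y \<bullet> (deflate B l x y *\<^sub>v v) = 0"
proof -
  have Bv: "B *\<^sub>v v \<in> carrier_vec m" using B v by simp
  have "y \<bullet> (deflate B l x y *\<^sub>v v) = y \<bullet> (B *\<^sub>v v) - y \<bullet> ((l / (y \<bullet> x) * (y \<bullet> v)) \<cdot>\<^sub>v x)"
    unfolding deflate_mult_vec[OF B x y v] by (rule scalar_prod_minus_distrib[OF y Bv]) (use x in simp)
  also have "\<dots> = 0" using x y v yx by (simp add: scalar_prod_mult_mat_vec[OF B y v] By)
  finally show ?thesis .
qed

text \<open>An eigenvector for a nonzero eigenvalue lies in the range of the deflated matrix, which
  \<open>y\<close> annihilates; and on such vectors the deflated matrix agrees with
  \<open>B\<close>.\<close>

lemma eigenvector_deflate:
  assumes B: "B \<in> carrier_mat m m" and x: "x \<in> carrier_vec m" and y: "y \<in> carrier_vec m"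
    and By: "transpose_mat B *\<^sub>v y = l \<cdot>\<^sub>v y" and yx: "y \<bullet> x \<noteq> 0"
    and ev: "eigenvector (deflate B l x y) v k" and k: "k \<noteq> 0"
  shows "y \<bullet> v = 0" "eigenvector B v k"
proof -
  have C: "deflate B l x y \<in> carrier_mat m m" using B x y by simp
  have v: "v \<in> carrier_vec m" "v \<noteq> 0\<^sub>v m" "deflate B l x y *\<^sub>v v = k \<cdot>\<^sub>v v"
    using ev carrier_matD[OF C] unfolding eigenvector_def by auto
  show yv: "y \<bullet> v = 0" using deflate_orthogonal[OF B x y v(1) By yx] k y v by simp
  have "B *\<^sub>v v = k \<cdot>\<^sub>v v"
    using v(3) unfolding deflate_mult_vec[OF B x y v(1)] yv using B x v
    by (auto simp: vec_eq_iff)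
  then show "eigenvector B v k" unfolding eigenvector_def using v B by auto
qed

text \<open>The deflated matrix times the rank-one part is zero, and the rank-one part times
  \<open>B\<close> is \<open>l\<close> times itself, so powers split without cross terms. The
  exponent starts at one because the identity fails for exponent zero.\<close>

lemma pow_mat_deflate:
  assumes B: "B \<in> carrier_mat m m" and x: "x \<in> carrier_vec m" and y: "y \<in> carrier_vec m"
    and Bx: "B *\<^sub>v x = l \<cdot>\<^sub>v x" and By: "transpose_mat B *\<^sub>v y = l \<cdot>\<^sub>v y" and yx: "y \<bullet> x \<noteq> 0"
  shows "B ^\<^sub>m Suc k = deflate B l x y ^\<^sub>m Suc k + (l ^ Suc k / (y \<bullet> x)) \<cdot>\<^sub>m outer_prod x y"
proof (induction k)
  case 0
  show ?case by (rule eq_matI) (insert B x y, auto simp: deflate_def outer_prod_def)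
next
  case (Suc k)
  let ?C = "deflate B l x y" and ?O = "outer_prod x y" and ?s = "y \<bullet> x"
  have C: "?C \<in> carrier_mat m m" and O: "?O \<in> carrier_mat m m" using B x y by auto
  have Ck: "?C ^\<^sub>m k \<in> carrier_mat m m" for k using C by simp
  have "?C *\<^sub>v x = 0\<^sub>v m"
    unfolding deflate_mult_vec[OF B x y x] Bx using yx x by (intro eq_vecI) auto
  then have CO: "?C * ?O = 0\<^sub>m m m"
    unfolding mult_outer_prod[OF C x y] using y by (auto simp: outer_prod_def)
  have OB: "?O * B = l \<cdot>\<^sub>m ?O"
    unfolding outer_prod_mult[OF B x y] By by (rule outer_prod_smult)
  have B_eq: "B = ?C + (l / ?s) \<cdot>\<^sub>m ?O"
    by (rule eq_matI) (insert B x y, auto simp: deflate_def outer_prod_def)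
  have "?C ^\<^sub>m Suc k * ?O = 0\<^sub>m m m"
    using assoc_mult_mat[OF Ck C O, of k] CO right_mult_zero_mat[OF Ck, of k m] by simp
  then have CkB: "?C ^\<^sub>m Suc k * B = ?C ^\<^sub>m Suc k * ?C"
    using mult_add_distrib_mat[OF Ck C, of "(l / ?s) \<cdot>\<^sub>m ?O" "Suc k"]
      mult_smult_distrib[OF Ck O, of "Suc k" "l / ?s"] C O Ck[of "Suc k"]
    by (subst B_eq) (simp del: pow_mat.simps assoc_mult_mat)
  have "B ^\<^sub>m Suc (Suc k) = (?C ^\<^sub>m Suc k + (l ^ Suc k / ?s) \<cdot>\<^sub>m ?O) * B"
    unfolding Suc[symmetric] by simp
  also have "\<dots> = ?C ^\<^sub>m Suc k * B + ((l ^ Suc k / ?s) \<cdot>\<^sub>m ?O) * B"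
    by (rule add_mult_distrib_mat[OF Ck smult_carrier_mat[OF O] B])
  also have "((l ^ Suc k / ?s) \<cdot>\<^sub>m ?O) * B = (l ^ Suc (Suc k) / ?s) \<cdot>\<^sub>m ?O"
    unfolding mult_smult_assoc_mat[OF O B] OB by (rule eq_matI) auto
  finally show ?case unfolding CkB by simp
qed

lemma map_mat_of_real_deflate:
  assumes "B \<in> carrier_mat m m" "x \<in> carrier_vec m" "y \<in> carrier_vec m"
  shows "map_mat complex_of_real (deflate B l x y)
    = deflate (map_mat complex_of_real B) (complex_of_real l) (map_vec complex_of_real x) (map_vec complex_of_real y)"
  by (rule eq_matI)
     (insert assms, auto simp: deflate_def outer_prod_def scalar_prod_def)

subsection \<open>Growth of matrix powers and positive matrices\<close>

lemma pow_mat_smult: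
  fixes A :: "'a :: comm_semiring_1 mat"
  assumes A: "A \<in> carrier_mat m m"
  shows "(a \<cdot>\<^sub>m A) ^\<^sub>m k = a ^ k \<cdot>\<^sub>m A ^\<^sub>m k"
proof (induction k)
  case 0
  show ?case using A by (auto intro!: eq_matI)
next
  case (Suc k)
  have Ak: "A ^\<^sub>m k \<in> carrier_mat m m" using A by simp
  have "(a \<cdot>\<^sub>m A) ^\<^sub>m Suc k = (a ^ k \<cdot>\<^sub>m A ^\<^sub>m k) * (a \<cdot>\<^sub>m A)" using Suc by simp
  also have "\<dots> = a ^ k \<cdot>\<^sub>m (a \<cdot>\<^sub>m (A ^\<^sub>m k * A))"
    using mult_smult_assoc_mat[OF Ak, of "a \<cdot>\<^sub>m A" m "a ^ k"] mult_smult_distrib[OF Ak A, of a] A by simp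
  also have "\<dots> = a ^ Suc k \<cdot>\<^sub>m A ^\<^sub>m Suc k"
    by (rule eq_matI) (insert A Ak, auto simp: ac_simps)
  finally show ?case .
qed

text \<open>Division by \<open>r\<close> brings the spectral radius below one, where the powers are
  bounded entrywise. The strict inequality \<open>cmod \<mu> < r\<close> absorbs the polynomial
  factors that Jordan blocks would produce.\<close>

lemma pow_mat_growth:
  fixes B :: "real mat"
  assumes B: "B \<in> carrier_mat m m" and r: "r > 0"
    and spec: "\<And>\<mu>. eigenvalue (map_mat complex_of_real B) \<mu> \<Longrightarrow> cmod \<mu> < r"
  shows "\<exists>b. \<forall>k. \<forall>i<m. \<forall>j<m. \<bar>(B ^\<^sub>m k) $$ (i, j)\<bar> \<le> b * r ^ k"
proof (cases "m = 0")
  case False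
  let ?B = "map_mat complex_of_real B"
  let ?A = "complex_of_real (1 / r) \<cdot>\<^sub>m ?B"
  have cB: "?B \<in> carrier_mat m m" and A: "?A \<in> carrier_mat m m" using B by auto
  obtain \<nu> where \<nu>: "eigenvalue ?A \<nu>" "spectral_radius ?A = cmod \<nu>"
    using spectral_radius_mem_max(1)[OF A] False unfolding spectrum_def by auto
  obtain v where v: "v \<in> carrier_vec m" "v \<noteq> 0\<^sub>v m" "?A *\<^sub>v v = \<nu> \<cdot>\<^sub>v v"
    using \<nu>(1) A B unfolding eigenvalue_def eigenvector_def by auto
  have "?B *\<^sub>v v = (of_real r * \<nu>) \<cdot>\<^sub>v v"
  proof (rule eq_vecI)
    fix i assume "i < dim_vec ((of_real r * \<nu>) \<cdot>\<^sub>v v)"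
    then have i: "i < m" using v by simp
    have "(?A *\<^sub>v v) $ i = of_real (1 / r) * (?B *\<^sub>v v) $ i"
      unfolding mult_mat_vec_index_sum[OF A v(1) i] mult_mat_vec_index_sum[OF cB v(1) i] sum_distrib_left
      by (rule sum.cong) (insert B i, auto)
    then have "of_real (1 / r) * (?B *\<^sub>v v) $ i = \<nu> * v $ i" using v i by simp
    then show "(?B *\<^sub>v v) $ i = ((of_real r * \<nu>) \<cdot>\<^sub>v v) $ i" using r v i by (simp add: field_simps)
  qed (insert B v, auto)
  then have "eigenvalue ?B (of_real r * \<nu>)"
    unfolding eigenvalue_def eigenvector_def using v B by auto
  from spec[OF this] have "cmod \<nu> < 1" using r by (simp add: norm_mult)
  with spectral_radius_jnf_norm_bound_less_1_upper_triangular[OF A] \<nu>(2)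
  obtain c where c: "\<And>k. norm_bound (?A ^\<^sub>m k) c" by auto
  have "\<bar>(B ^\<^sub>m k) $$ (i, j)\<bar> \<le> c * r ^ k" if ij: "i < m" "j < m" for k i j
  proof -
    have "?A ^\<^sub>m k = of_real (1 / r) ^ k \<cdot>\<^sub>m map_mat complex_of_real (B ^\<^sub>m k)"
      unfolding pow_mat_smult[OF cB] of_real_hom.mat_hom_pow[OF B] ..
    then have "(?A ^\<^sub>m k) $$ (i, j) = of_real ((1 / r) ^ k * (B ^\<^sub>m k) $$ (i, j))"
      using B ij by simp
    moreover have "cmod ((?A ^\<^sub>m k) $$ (i, j)) \<le> c"
      by (rule c[of k, unfolded norm_bound_def, rule_format])
         (insert carrier_matD[OF pow_carrier_mat[OF A, of k]] ij, simp_all only:)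
    ultimately have "\<bar>(1 / r) ^ k * (B ^\<^sub>m k) $$ (i, j)\<bar> \<le> c"
      by (simp only: norm_of_real)
    then show ?thesis using r by (simp add: abs_mult field_simps)
  qed
  then show ?thesis by blast
qed simp

text \<open>Equality in the triangle inequality. After rotation by the phase \<open>u\<close> of the
  sum, the real parts add up to the moduli, so each real part equals its modulus and no imaginary
  part is left.\<close>

lemma norm_sum_eq_sum_norm_imp_aligned:
  fixes f :: "'b \<Rightarrow> complex"
  assumes fin: "finite S" and eq: "cmod (sum f S) = (\<Sum>j\<in>S. cmod (f j))"
  shows "\<exists>u. cmod u = 1 \<and> (\<forall>j\<in>S. f j = u * of_real (cmod (f j)))"
proof (cases "sum f S = 0")
  case True
  then have "\<forall>j\<in>S. f j = 0" using eq fin by (simp add: sum_nonneg_eq_0_iff)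
  then show ?thesis by (intro exI[of _ 1]) auto
next
  case False
  define u where "u = sgn (sum f S)"
  have u: "cmod u = 1" using False unfolding u_def by (simp add: norm_sgn)
  then have uu: "u * cnj u = 1" by (metis complex_norm_square mult_1_right of_real_1 power_one)
  have "sum f S = u * of_real (cmod (sum f S))"
    unfolding u_def by (simp add: sgn_eq False)
  then have "cnj u * sum f S = of_real (cmod (sum f S))"
    using uu by (metis mult.assoc mult.commute mult_1)
  then have "(\<Sum>j\<in>S. Re (cnj u * f j)) = (\<Sum>j\<in>S. cmod (f j))"
    using eq by (metis Re_complex_of_real Re_sum sum_distrib_left)
  then have "(\<Sum>j\<in>S. cmod (f j) - Re (cnj u * f j)) = 0" by (simp add: sum_subtractf)
  moreover have le: "Re (cnj u * f j) \<le> cmod (f j)" for j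
    using complex_Re_le_cmod[of "cnj u * f j"] u by (simp add: norm_mult)
  ultimately have re: "Re (cnj u * f j) = cmod (f j)" if "j \<in> S" for j
    using that fin by (subst (asm) sum_nonneg_eq_0_iff) auto
  have "f j = u * of_real (cmod (f j))" if j: "j \<in> S" for j
  proof -
    let ?z = "cnj u * f j"
    have "cmod ?z = Re ?z" using re[OF j] u by (simp add: norm_mult)
    then have "Im ?z = 0" unfolding cmod_def
      by (metis add_cancel_left_right cmod_def cmod_power2 power2_eq_square zero_eq_power2)
    then have "?z = of_real (cmod (f j))" using re[OF j] by (simp add: complex_eq_iff)
    then show ?thesis using uu by (metis mult.assoc mult_1)
  qed
  then show ?thesis using u by blast
qed

section \<open>Perron's argument for positive matrices\<close>

lemma pow_mat_nonneg:
  fixes P :: "real mat"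
  assumes P: "P \<in> carrier_mat m m" and pos: "\<And>i j. i < m \<Longrightarrow> j < m \<Longrightarrow> 0 \<le> P $$ (i, j)"
  shows "i < m \<Longrightarrow> j < m \<Longrightarrow> 0 \<le> (P ^\<^sub>m k) $$ (i, j)"
proof (induction k arbitrary: j)
  case 0
  then show ?case using P by simp
next
  case (Suc k)
  have "(P ^\<^sub>m Suc k) $$ (i, j) = (\<Sum>h<m. (P ^\<^sub>m k) $$ (i, h) * P $$ (h, j))"
    using P Suc.prems by (auto simp: scalar_prod_def lessThan_atLeast0 intro!: sum.cong)
  then show ?case using Suc pos by (auto intro!: sum_nonneg mult_nonneg_nonneg)
qed

text \<open>A Collatz--Wielandt bound: a nonnegative matrix preserves entrywise inequalities, so a
  stretching by at least \<open>c\<close> in every coordinate can be iterated.\<close>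

lemma pow_mat_vec_lower_bound:
  fixes P :: "real mat"
  assumes P: "P \<in> carrier_mat m m" and pos: "\<And>i j. i < m \<Longrightarrow> j < m \<Longrightarrow> 0 \<le> P $$ (i, j)"
    and w: "w \<in> carrier_vec m" and c: "0 \<le> c" and Pw: "\<And>i. i < m \<Longrightarrow> c * w $ i \<le> (P *\<^sub>v w) $ i"
  shows "i < m \<Longrightarrow> c ^ k * w $ i \<le> (P ^\<^sub>m k *\<^sub>v w) $ i"
proof (induction k)
  case 0
  then show ?case using P w by simp
next
  case (Suc k)
  have Pk: "P ^\<^sub>m k \<in> carrier_mat m m" and Pw': "P *\<^sub>v w \<in> carrier_vec m" using P w by auto
  have "c ^ Suc k * w $ i \<le> c * (P ^\<^sub>m k *\<^sub>v w) $ i"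
    using Suc c by (simp add: mult.assoc mult_left_mono)
  also have "\<dots> = (\<Sum>j<m. (P ^\<^sub>m k) $$ (i, j) * (c * w $ j))"
    unfolding mult_mat_vec_index_sum[OF Pk w Suc.prems] sum_distrib_left by (simp add: ac_simps)
  also have "\<dots> \<le> (\<Sum>j<m. (P ^\<^sub>m k) $$ (i, j) * (P *\<^sub>v w) $ j)"
    using pow_mat_nonneg[OF P pos] Pw Suc.prems by (intro sum_mono mult_left_mono) auto
  also have "\<dots> = (P ^\<^sub>m k *\<^sub>v (P *\<^sub>v w)) $ i"
    unfolding mult_mat_vec_index_sum[OF Pk Pw' Suc.prems] ..
  also have "\<dots> = (P ^\<^sub>m Suc k *\<^sub>v w) $ i"
    using assoc_mult_mat_vec[OF Pk P w] by simp
  finally show ?case .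
qed

text \<open>The growth hypothesis says that the modulus of \<^term>\<open>\<mu>\<close> is the spectral radius.\<close>

lemma perron_dominant_eigenvector:
  fixes P :: "real mat" and v :: "complex vec"
  assumes P: "P \<in> carrier_mat m m" and pos: "\<And>i j. i < m \<Longrightarrow> j < m \<Longrightarrow> 0 < P $$ (i, j)"
    and ev: "eigenvector (map_mat complex_of_real P) v \<mu>"
    and growth: "\<And>r. cmod \<mu> < r \<Longrightarrow> \<exists>b. \<forall>k. \<forall>i<m. \<forall>j<m. \<bar>(P ^\<^sub>m k) $$ (i, j)\<bar> \<le> b * r ^ k"
  shows "\<mu> = of_real (cmod \<mu>)" "0 < cmod \<mu>"
    "\<exists>u. cmod u = 1 \<and> (\<forall>i<m. v $ i \<noteq> 0 \<and> v $ i = u * of_real (cmod (v $ i)))"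
proof -
  let ?P = "map_mat complex_of_real P"
  have cP: "?P \<in> carrier_mat m m" using P by simp
  have v: "v \<in> carrier_vec m" "v \<noteq> 0\<^sub>v m" and Pv: "?P *\<^sub>v v = \<mu> \<cdot>\<^sub>v v"
    using ev P unfolding eigenvector_def by auto
  define a where "a i = cmod (v $ i)" for i
  define w where "w = vec m (\<lambda>i. \<Sum>j<m. P $$ (i, j) * a j)"
  have w: "w \<in> carrier_vec m" unfolding w_def by simp
  have wi: "w $ i = (\<Sum>j<m. P $$ (i, j) * a j)" if "i < m" for i using that unfolding w_def by simp
  obtain i0 where i0: "i0 < m" "v $ i0 \<noteq> 0" using v by (auto simp: vec_eq_iff)
  have wpos: "0 < w $ i" if i: "i < m" for i
    unfolding wi[OF i]
    by (rule sum_pos2[of _ i0]) (insert i0 pos[OF i] i, auto simp: a_def less_imp_le)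
  have Pvi: "(\<Sum>j<m. of_real (P $$ (i, j)) * v $ j) = \<mu> * v $ i" if i: "i < m" for i
  proof -
    have "(?P *\<^sub>v v) $ i = (\<Sum>j<m. of_real (P $$ (i, j)) * v $ j)"
      unfolding mult_mat_vec_index_sum[OF cP v(1) i] by (rule sum.cong) (insert P i, auto)
    then show ?thesis using Pv v i by simp
  qed
  have le: "cmod \<mu> * a i \<le> w $ i" if i: "i < m" for i
  proof -
    have "cmod \<mu> * a i = cmod (\<Sum>j<m. of_real (P $$ (i, j)) * v $ j)"
      unfolding Pvi[OF i] a_def by (simp add: norm_mult)
    also have "\<dots> \<le> (\<Sum>j<m. cmod (of_real (P $$ (i, j)) * v $ j))" by (rule norm_sum)
    also have "\<dots> = w $ i"
      unfolding wi[OF i] a_def by (rule sum.cong) (insert pos[OF i], auto simp: norm_mult less_imp_le)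
    finally show ?thesis .
  qed
  \<comment> \<open>Here \<open>w\<close> is \<open>P\<close> applied to the moduli of
    \<open>v\<close>. If \<open>le\<close> were strict in one coordinate, the positive
    \<open>P\<close> would spread strictness to all coordinates, so \<open>P\<close> would stretch
    \<open>w\<close> by some \<open>c > cmod \<mu>\<close>, and its powers would outgrow the bound
    in \<open>growth\<close>.\<close>
  have eq: "cmod \<mu> * a i = w $ i" if i: "i < m" for i
  proof (rule ccontr)
    assume "cmod \<mu> * a i \<noteq> w $ i"
    with le[OF i] have less: "cmod \<mu> * a i < w $ i" by simp
    let ?q = "\<lambda>h. (P *\<^sub>v w) $ h / w $ h"
    have gt: "cmod \<mu> < ?q h" if h: "h < m" for h
    proof -
      have "cmod \<mu> * w $ h = (\<Sum>j<m. P $$ (h, j) * (cmod \<mu> * a j))"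
        unfolding wi[OF h] sum_distrib_left by (simp add: ac_simps)
      also have "\<dots> < (\<Sum>j<m. P $$ (h, j) * w $ j)"
        by (rule sum_strict_mono_ex1)
           (insert less i le pos[OF h], auto intro!: mult_left_mono mult_strict_left_mono bexI[of _ i] less_imp_le)
      also have "\<dots> = (P *\<^sub>v w) $ h" by (rule mult_mat_vec_index_sum[OF P w h, symmetric])
      finally show ?thesis using wpos[OF h] by (simp add: field_simps)
    qed
    define c where "c = Min (?q ` {..<m})"
    have ne: "?q ` {..<m} \<noteq> {}" using i by auto
    have c: "cmod \<mu> < c" unfolding c_def using ne gt by (subst Min_gr_iff) auto
    have "c * w $ h \<le> (P *\<^sub>v w) $ h" if h: "h < m" for h
    proof -
      have "c \<le> ?q h" unfolding c_def using h by (intro Min_le) auto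
      then show ?thesis using wpos[OF h] by (simp add: field_simps)
    qed
    then have low: "c ^ k * w $ i \<le> (P ^\<^sub>m k *\<^sub>v w) $ i" for k
      using pow_mat_vec_lower_bound[OF P _ w, of c i k] pos c i norm_ge_zero[of \<mu>]
      by (meson less_imp_le order_trans)
    \<comment> \<open>Any rate strictly between serves: above \<open>cmod \<mu>\<close> for
      \<open>growth\<close> to apply, below \<open>c\<close> for the powers of \<open>c / r\<close>
      to be unbounded.\<close>
    define r where "r = (cmod \<mu> + c) / 2"
    have r: "cmod \<mu> < r" "r < c" "0 < r" 
      using c le_less_trans[OF norm_ge_zero c] unfolding r_def by (simp_all add: add_nonneg_pos)
    obtain b where b: "\<And>k j. j < m \<Longrightarrow> \<bar>(P ^\<^sub>m k) $$ (i, j)\<bar> \<le> b * r ^ k"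
      using growth[OF r(1)] i by blast
    have up: "(P ^\<^sub>m k *\<^sub>v w) $ i \<le> b * r ^ k * (\<Sum>j<m. w $ j)" for k
    proof -
      have "(P ^\<^sub>m k *\<^sub>v w) $ i = (\<Sum>j<m. (P ^\<^sub>m k) $$ (i, j) * w $ j)"
        by (rule mult_mat_vec_index_sum[OF pow_carrier_mat[OF P] w i])
      also have "\<dots> \<le> (\<Sum>j<m. b * r ^ k * w $ j)"
        using b[of _ k] wpos by (intro sum_mono mult_right_mono) (auto simp: less_imp_le abs_le_iff)
      finally show ?thesis by (simp add: sum_distrib_left)
    qed
    have "(c / r) ^ k \<le> b * (\<Sum>j<m. w $ j) / w $ i" for k
    proof -
      have "c ^ k * w $ i \<le> b * r ^ k * (\<Sum>j<m. w $ j)" using low[of k] up[of k] by linarith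
      then show ?thesis using r wpos[OF i] by (simp add: power_divide field_simps)
    qed
    moreover obtain k where "b * (\<Sum>j<m. w $ j) / w $ i < (c / r) ^ k"
      using real_arch_pow[of "c / r" "b * (\<Sum>j<m. w $ j) / w $ i"] r by auto
    ultimately show False by (meson not_le)
  qed
  show \<mu>pos: "0 < cmod \<mu>" using eq[OF i0(1)] wpos[OF i0(1)] by (cases "\<mu> = 0") auto
  have apos: "0 < a i" if "i < m" for i
    using eq[OF that] wpos[OF that] \<mu>pos by (metis zero_less_mult_pos)
  \<comment> \<open>A single row suffices: equality in row \<open>i0\<close> aligns its terms, and
    as the entries of that row are positive, the phase is that of every coordinate of
    \<open>v\<close>.\<close>
  have "cmod (\<Sum>j<m. of_real (P $$ (i0, j)) * v $ j) = (\<Sum>j<m. cmod (of_real (P $$ (i0, j)) * v $ j))"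
  proof -
    have "(\<Sum>j<m. cmod (of_real (P $$ (i0, j)) * v $ j)) = w $ i0"
      unfolding wi[OF i0(1)] a_def by (rule sum.cong) (insert pos[OF i0(1)], auto simp: norm_mult less_imp_le)
    then show ?thesis unfolding Pvi[OF i0(1)] using eq[OF i0(1)] by (simp add: norm_mult a_def)
  qed
  from norm_sum_eq_sum_norm_imp_aligned[OF _ this]
  obtain u where u: "cmod u = 1" and al: "\<And>j. j < m \<Longrightarrow>
      of_real (P $$ (i0, j)) * v $ j = u * of_real (cmod (of_real (P $$ (i0, j)) * v $ j))"
    by auto
  have va: "v $ j = u * of_real (a j)" if j: "j < m" for j
    using al[OF j] pos[OF i0(1) j] unfolding a_def by (simp add: norm_mult)
  then show "\<exists>u. cmod u = 1 \<and> (\<forall>i<m. v $ i \<noteq> 0 \<and> v $ i = u * of_real (cmod (v $ i)))"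
    using u apos unfolding a_def by (intro exI[of _ u]) auto
  have "\<mu> * v $ i0 = (\<Sum>j<m. of_real (P $$ (i0, j)) * (u * of_real (a j)))"
    unfolding Pvi[OF i0(1), symmetric] using va by (intro sum.cong) auto
  also have "\<dots> = u * of_real (w $ i0)"
    unfolding wi[OF i0(1)] of_real_sum sum_distrib_left by (rule sum.cong) auto
  also have "\<dots> = of_real (cmod \<mu>) * v $ i0"
    unfolding eq[OF i0(1), symmetric] va[OF i0(1)] by simp
  finally show "\<mu> = of_real (cmod \<mu>)" using i0 by simp
qed

subsection \<open>Signature equality and eventual sign symmetry\<close>

text \<open>Sign symmetry through a signature vector in place of a subset: with \<open>D\<close> the
  diagonal matrix of \<open>d\<close>, it says that \<open>D B D\<close> is entrywise positive. In
  this form it is a similarity, since \<open>D\<close> is its own inverse.\<close>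

definition signed_positive :: "(nat \<Rightarrow> real) \<Rightarrow> real mat \<Rightarrow> bool" where
  "signed_positive d B \<longleftrightarrow> (\<forall>i<dim_row B. \<bar>d i\<bar> = 1) \<and>
     (\<forall>i<dim_row B. \<forall>j<dim_row B. 0 < d i * d j * B $$ (i, j))"

lemma SJS_iff_signed_positive: "SJS B \<longleftrightarrow> (\<exists>d. signed_positive d B)"
proof
  assume "SJS B"
  then obtain J where J: "\<forall>i < dim_row B. \<forall>k < dim_row B.
      ((i \<in> J \<longleftrightarrow> k \<in> J) \<longrightarrow> B $$ (i, k) > 0) \<and> (\<not> (i \<in> J \<longleftrightarrow> k \<in> J) \<longrightarrow> B $$ (i, k) < 0)"
    unfolding SJS_def by (elim exE conjE)
  have "signed_positive (\<lambda>i. if i \<in> J then 1 else -1) B"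
    unfolding signed_positive_def using J by simp
  then show "\<exists>d. signed_positive d B" by blast
next
  assume "\<exists>d. signed_positive d B"
  then obtain d where d: "\<And>i. i < dim_row B \<Longrightarrow> \<bar>d i\<bar> = 1"
    "\<And>i j. i < dim_row B \<Longrightarrow> j < dim_row B \<Longrightarrow> 0 < d i * d j * B $$ (i, j)"
    unfolding signed_positive_def by blast
  have d1: "d i = 1 \<or> d i = -1" if "i < dim_row B" for i using d(1)[OF that] by linarith
  show "SJS B" unfolding SJS_def
  proof (intro exI[of _ "{i. i < dim_row B \<and> d i = 1}"] conjI allI impI)
    fix i k assume ik: "i < dim_row B" "k < dim_row B"
    let ?J = "{i. i < dim_row B \<and> d i = 1}"
    show "B $$ (i, k) > 0" if "i \<in> ?J \<longleftrightarrow> k \<in> ?J"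
      using that d(2)[OF ik] d1[OF ik(1)] d1[OF ik(2)] ik by auto
    show "B $$ (i, k) < 0" if "\<not> (i \<in> ?J \<longleftrightarrow> k \<in> ?J)"
      using that d(2)[OF ik] d1[OF ik(1)] d1[OF ik(2)] ik by auto
  qed auto
qed

section \<open>Perron's argument for a matrix with a sign-symmetric power\<close>

lemma pow_mat_pow:
  fixes A :: "'a :: semiring_1 mat"
  assumes A: "A \<in> carrier_mat m m"
  shows "(A ^\<^sub>m a) ^\<^sub>m b = A ^\<^sub>m (a * b)"
proof -
  interpret semiring "ring_mat TYPE('a) m ()" by (rule semiring_mat)
  have "A \<in> carrier (ring_mat TYPE('a) m ())" using A by (simp add: ring_mat_def)
  from nat_pow_pow[OF this] show ?thesis
    using pow_mat_ring_pow[OF A, of _ "()"] pow_mat_ring_pow[OF pow_carrier_mat[OF A], of _ _ "()"] by simp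
qed

lemma pow_mat_commute:
  fixes A :: "'a :: semiring_1 mat"
  assumes A: "A \<in> carrier_mat m m"
  shows "A * A ^\<^sub>m k = A ^\<^sub>m k * A"
proof (induction k)
  case (Suc k)
  have "A * A ^\<^sub>m Suc k = A * A ^\<^sub>m k * A"
    using assoc_mult_mat[OF A pow_carrier_mat[OF A, of k] A] by simp
  then show ?case using Suc by simp
qed (use A in simp)

lemma pow_mat_transpose:
  fixes A :: "'a :: comm_semiring_1 mat"
  assumes A: "A \<in> carrier_mat m m"
  shows "transpose_mat A ^\<^sub>m k = transpose_mat (A ^\<^sub>m k)"
proof (induction k)
  case 0
  then show ?case using A by simp
next
  case (Suc k)
  then show ?case
    using transpose_mult[OF A pow_carrier_mat[OF A, of k]] pow_mat_commute[OF A, of k] by simp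
qed

text \<open>With \<open>D\<close> the diagonal matrix of \<open>d\<close>, the matrix
  \<open>D B^k D\<close> is positive and has eigenvector \<open>D v\<close> for
  \<open>\<mu> ^ k\<close>, so Perron's argument applies. Undoing \<open>D\<close> gives
  \<open>v\<close> the sign pattern \<open>d\<close>, up to one complex phase.\<close>

lemma dominant_eigenvector_signed:
  fixes B :: "real mat" and v :: "complex vec"
  assumes B: "B \<in> carrier_mat m m" and k: "k > 0" and d: "signed_positive d (B ^\<^sub>m k)"
    and ev: "eigenvector (map_mat complex_of_real B) v \<mu>"
    and growth: "\<And>r. cmod \<mu> < r \<Longrightarrow> \<exists>b. \<forall>k. \<forall>i<m. \<forall>j<m. \<bar>(B ^\<^sub>m k) $$ (i, j)\<bar> \<le> b * r ^ k"
  shows "\<mu> ^ k = of_real (cmod \<mu> ^ k)" "0 < cmod \<mu>"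
    "\<exists>u. cmod u = 1 \<and> (\<forall>i<m. v $ i \<noteq> 0 \<and> v $ i = u * of_real (d i * cmod (v $ i)))"
proof -
  let ?B = "map_mat complex_of_real B"
  define Q where "Q = B ^\<^sub>m k"
  have Q: "Q \<in> carrier_mat m m" unfolding Q_def using B by simp
  have cQ: "map_mat complex_of_real Q \<in> carrier_mat m m" using Q by simp
  have d1: "\<bar>d i\<bar> = 1" and dQ: "j < m \<Longrightarrow> 0 < d i * d j * Q $$ (i, j)" if "i < m" for i j
    using d that carrier_matD[OF Q] unfolding signed_positive_def Q_def[symmetric] by auto
  have dd: "d i * d i = 1" if "i < m" for i
    using d1[OF that] by (metis abs_mult_self_eq mult_1)
  define P where "P = mat m m (\<lambda>(i, j). d i * d j * Q $$ (i, j))"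
  have P: "P \<in> carrier_mat m m" unfolding P_def by simp
  have cP: "map_mat complex_of_real P \<in> carrier_mat m m" using P by simp
  \<comment> \<open>\<open>D D = 1\<close> cancels between consecutive factors.\<close>
  have Ppow: "i < m \<Longrightarrow> j < m \<Longrightarrow> (P ^\<^sub>m t) $$ (i, j) = d i * d j * (Q ^\<^sub>m t) $$ (i, j)" for t i j
  proof (induction t arbitrary: j)
    case 0
    then show ?case using P Q dd by auto
  next
    case (Suc t)
    have "(P ^\<^sub>m Suc t) $$ (i, j) = (\<Sum>h<m. (P ^\<^sub>m t) $$ (i, h) * P $$ (h, j))"
      using P Suc.prems by (auto simp: scalar_prod_def lessThan_atLeast0 intro!: sum.cong)
    also have "\<dots> = (\<Sum>h<m. d i * d j * ((Q ^\<^sub>m t) $$ (i, h) * Q $$ (h, j)))"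
    proof (rule sum.cong[OF refl])
      fix h assume "h \<in> {..<m}"
      then have h: "h < m" by simp
      have "(P ^\<^sub>m t) $$ (i, h) * P $$ (h, j)
          = (d h * d h) * (d i * d j * ((Q ^\<^sub>m t) $$ (i, h) * Q $$ (h, j)))"
        unfolding Suc.IH[OF Suc.prems(1) h] using h Suc.prems by (simp add: P_def ac_simps)
      then show "(P ^\<^sub>m t) $$ (i, h) * P $$ (h, j) = d i * d j * ((Q ^\<^sub>m t) $$ (i, h) * Q $$ (h, j))"
        unfolding dd[OF h] by simp
    qed
    also have "\<dots> = d i * d j * (Q ^\<^sub>m Suc t) $$ (i, j)"
      unfolding sum_distrib_left[symmetric]
      using Q Suc.prems by (auto simp: scalar_prod_def lessThan_atLeast0 intro!: sum.cong)
    finally show ?case .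
  qed
  have v: "v \<in> carrier_vec m" "v \<noteq> 0\<^sub>v m" using ev B unfolding eigenvector_def by auto
  have "map_mat complex_of_real Q *\<^sub>v v = \<mu> ^ k \<cdot>\<^sub>v v"
    unfolding Q_def of_real_hom.mat_hom_pow[OF B] using B ev by (intro eigenvector_pow) auto
  then have Qv: "(\<Sum>j<m. of_real (Q $$ (i, j)) * v $ j) = \<mu> ^ k * v $ i" if i: "i < m" for i
    using mult_mat_vec_index_sum[OF cQ v(1) i] Q v i by (auto intro!: sum.cong)
  define w where "w = vec m (\<lambda>i. of_real (d i) * v $ i)"
  have w: "w \<in> carrier_vec m" unfolding w_def by simp
  have dw: "of_real (d i) * w $ i = v $ i" if "i < m" for i
    using that arg_cong[OF dd[OF that], of complex_of_real] unfolding w_def by (simp flip: mult.assoc)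
  have "w \<noteq> 0\<^sub>v m"
  proof
    assume "w = 0\<^sub>v m"
    then have "v = 0\<^sub>v m" using dw v by (intro eq_vecI) fastforce+
    then show False using v by simp
  qed
  moreover have "map_mat complex_of_real P *\<^sub>v w = \<mu> ^ k \<cdot>\<^sub>v w"
  proof (rule eq_vecI)
    fix i assume "i < dim_vec (\<mu> ^ k \<cdot>\<^sub>v w)"
    then have i: "i < m" using w by simp
    have "(map_mat complex_of_real P *\<^sub>v w) $ i = (\<Sum>j<m. of_real (d i) * (of_real (Q $$ (i, j)) * (of_real (d j) * w $ j)))"
      unfolding mult_mat_vec_index_sum[OF cP w i]
      by (rule sum.cong) (insert i P, auto simp: P_def)
    also have "\<dots> = of_real (d i) * (\<Sum>j<m. of_real (Q $$ (i, j)) * v $ j)"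
      unfolding sum_distrib_left using dw by (intro sum.cong) auto
    also have "\<dots> = \<mu> ^ k * w $ i" unfolding Qv[OF i] using i by (simp add: w_def)
    finally show "(map_mat complex_of_real P *\<^sub>v w) $ i = (\<mu> ^ k \<cdot>\<^sub>v w) $ i" using w i by simp
  qed (insert P w, auto)
  ultimately have evP: "eigenvector (map_mat complex_of_real P) w (\<mu> ^ k)"
    unfolding eigenvector_def using w P by auto
  \<comment> \<open>The powers of \<open>P\<close> are, up to signs, those of \<open>B\<close> at
    exponents \<open>k * t\<close>, so a rate \<open>r\<close> for \<open>P\<close> is the rate
    \<open>root k r\<close> for \<open>B\<close>.\<close>
  have growthP: "\<exists>b. \<forall>t. \<forall>i<m. \<forall>j<m. \<bar>(P ^\<^sub>m t) $$ (i, j)\<bar> \<le> b * r ^ t" if r: "cmod (\<mu> ^ k) < r" for r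
  proof -
    have r0: "0 \<le> r" using r norm_ge_zero[of "\<mu> ^ k"] by linarith
    let ?s = "root k r"
    have s: "?s ^ k = r" using k r0 by simp
    have "cmod \<mu> < ?s"
      by (rule power_less_imp_less_base[of _ k]) (insert r s r0 k, auto simp: norm_power)
    from growth[OF this] obtain b where
      b: "\<And>t i j. i < m \<Longrightarrow> j < m \<Longrightarrow> \<bar>(B ^\<^sub>m t) $$ (i, j)\<bar> \<le> b * ?s ^ t" by blast
    have "\<bar>(P ^\<^sub>m t) $$ (i, j)\<bar> \<le> b * r ^ t" if "i < m" "j < m" for t i j
      using b[OF that, of "k * t"] d1 that
      unfolding Ppow[OF that] Q_def pow_mat_pow[OF B] power_mult s by (simp add: abs_mult)
    then show ?thesis by blast
  qed
  have Ppos: "0 < P $$ (i, j)" if "i < m" "j < m" for i j using dQ that unfolding P_def by simp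
  note res = perron_dominant_eigenvector[OF P Ppos evP growthP]
  show "\<mu> ^ k = of_real (cmod \<mu> ^ k)" using res(1) by (simp add: norm_power)
  show "0 < cmod \<mu>" using res(2) k by (cases "\<mu> = 0") (auto simp: norm_power zero_power)
  obtain u where u: "cmod u = 1" "\<And>i. i < m \<Longrightarrow> w $ i \<noteq> 0 \<and> w $ i = u * of_real (cmod (w $ i))"
    using res(3) by blast
  have "v $ i \<noteq> 0 \<and> v $ i = u * of_real (d i * cmod (v $ i))" if i: "i < m" for i
  proof -
    have wi: "w $ i = of_real (d i) * v $ i" using i unfolding w_def by simp
    have "cmod (w $ i) = cmod (v $ i)" unfolding wi using d1[OF i] by (simp add: norm_mult)
    then have "v $ i = of_real (d i) * (u * of_real (cmod (v $ i)))"
      using dw[OF i] u(2)[OF i] by metis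
    then have "v $ i = u * of_real (d i * cmod (v $ i))"
      by (metis mult.left_commute of_real_mult)
    moreover have "v $ i \<noteq> 0" using u(2)[OF i] wi by auto
    ultimately show ?thesis by blast
  qed
  then show "\<exists>u. cmod u = 1 \<and> (\<forall>i<m. v $ i \<noteq> 0 \<and> v $ i = u * of_real (d i * cmod (v $ i)))"
    using u(1) by blast
qed

text \<open>Dividing the complex eigenvector by its common phase \<open>u\<close> leaves the real
  vector with entries \<open>d i * cmod (v $ i)\<close>, still an eigenvector because the eigenvalue
  is real.\<close>

lemma dominant_real_eigenvector_signed:
  fixes B :: "real mat" and \<rho> :: real
  assumes B: "B \<in> carrier_mat m m" and k: "k > 0" and d: "signed_positive d (B ^\<^sub>m k)"
    and ev: "eigenvalue (map_mat complex_of_real B) (of_real \<rho>)" and \<rho>: "0 \<le> \<rho>"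
    and growth: "\<And>r. \<rho> < r \<Longrightarrow> \<exists>b. \<forall>k. \<forall>i<m. \<forall>j<m. \<bar>(B ^\<^sub>m k) $$ (i, j)\<bar> \<le> b * r ^ k"
  shows "\<exists>x. eigenvector B x \<rho> \<and> (\<forall>i<m. 0 < d i * x $ i)"
proof -
  let ?B = "map_mat complex_of_real B"
  have cB: "?B \<in> carrier_mat m m" using B by simp
  obtain v where v: "eigenvector ?B v (of_real \<rho>)" using ev unfolding eigenvalue_def by blast
  have vc: "v \<in> carrier_vec m" "v \<noteq> 0\<^sub>v m" "?B *\<^sub>v v = of_real \<rho> \<cdot>\<^sub>v v"
    using v B unfolding eigenvector_def by auto
  have "cmod (of_real \<rho>) = \<rho>" using \<rho> by simp
  with dominant_eigenvector_signed(3)[OF B k d v] growth obtain u where u: "cmod u = 1"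
    "\<And>i. i < m \<Longrightarrow> v $ i \<noteq> 0 \<and> v $ i = u * of_real (d i * cmod (v $ i))" by metis
  have d1: "\<bar>d i\<bar> = 1" if "i < m" for i
    using d that B unfolding signed_positive_def by auto
  have dd: "d i * d i = 1" if "i < m" for i
    using d1[OF that] by (metis abs_mult_self_eq mult_1)
  define x where "x = vec m (\<lambda>i. d i * cmod (v $ i))"
  have x: "x \<in> carrier_vec m" unfolding x_def by simp
  have cx: "map_vec complex_of_real x = (1 / u) \<cdot>\<^sub>v v"
  proof (rule eq_vecI)
    fix i assume "i < dim_vec ((1 / u) \<cdot>\<^sub>v v)"
    then have i: "i < m" using vc by simp
    have "u \<noteq> 0" using u(1) by auto
    then have "of_real (d i * cmod (v $ i)) = 1 / u * v $ i"
      using u(2)[OF i] by (metis nonzero_mult_div_cancel_left times_divide_eq_left mult_1)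
    then show "map_vec complex_of_real x $ i = ((1 / u) \<cdot>\<^sub>v v) $ i" using i vc by (simp add: x_def)
  qed (insert vc x, auto)
  have pos: "0 < d i * x $ i" if i: "i < m" for i
    using u(2)[OF i] dd[OF i] i unfolding x_def by (simp flip: mult.assoc)
  have "?B *\<^sub>v map_vec complex_of_real x = of_real \<rho> \<cdot>\<^sub>v map_vec complex_of_real x"
    unfolding cx mult_mat_vec[OF cB vc(1)] vc(3) by (simp add: smult_smult_assoc mult.commute)
  moreover have "map_vec complex_of_real x \<noteq> 0\<^sub>v m"
  proof -
    obtain i where i: "i < m" using vc by (auto simp: vec_eq_iff)
    then have "x $ i \<noteq> 0" using pos[OF i] by auto
    then show ?thesis using i x by (auto simp: vec_eq_iff)
  qed
  ultimately have "eigenvector ?B (map_vec complex_of_real x) (of_real \<rho>)"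
    unfolding eigenvector_def using x B by auto
  then have "eigenvector B x \<rho>" by (rule of_real_hom.eigenvector_hom_rev[OF B])
  then show ?thesis using pos by blast
qed

lemma Sign_eq_sgn:
  "Sign x = Sign y \<Longrightarrow> x \<in> carrier_vec m \<Longrightarrow> y \<in> carrier_vec m \<Longrightarrow> i < m \<Longrightarrow> sgn (x $ i) = sgn (y $ i)"
  unfolding Sign_def by (metis carrier_vecD index_map_vec(1))

text \<open>Every summand is positive. This supplies the nonzero pairing of left and right
  eigenvectors by which deflation divides.\<close>

lemma Sign_eq_scalar_prod_pos:
  assumes x: "x \<in> carrier_vec m" and y: "y \<in> carrier_vec m" and m: "m > 0"
    and "no_zero_coords x" "Sign x = Sign y"
  shows "y \<bullet> x > 0"
proof -
  have "0 < y $ i * x $ i" if i: "i < m" for i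
  proof -
    have "x $ i \<noteq> 0" using assms i unfolding no_zero_coords_def by auto
    then show ?thesis using Sign_eq_sgn[OF assms(5) x y i]
      by (auto simp: sgn_if zero_less_mult_iff split: if_splits)
  qed
  moreover have "y \<bullet> x = (\<Sum>i<m. y $ i * x $ i)"
    using x by (simp add: scalar_prod_def lessThan_atLeast0)
  ultimately show ?thesis using m by (auto intro!: sum_pos)
qed

lemma eventually_SJS_imp_signature_equality:
  fixes B :: "real mat"
  assumes B: "B \<in> carrier_mat m m" and m: "m > 0" and "eventually_SJS B"
  shows "signature_equality B"
proof -
  let ?B = "map_mat complex_of_real B" and ?T = "transpose_mat B"
  have cB: "?B \<in> carrier_mat m m" and T: "?T \<in> carrier_mat m m" using B by auto
  obtain k0 where "\<forall>k\<ge>k0. SJS (B ^\<^sub>m k)" using assms(3) unfolding eventually_SJS_def by blast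
  \<comment> \<open>Starting at \<open>Suc k0\<close> makes the exponent positive, as the Perron
    step for powers requires.\<close>
  then have "SJS (B ^\<^sub>m Suc k0)" "SJS (B ^\<^sub>m Suc (Suc k0))" by (simp_all del: pow_mat.simps)
  then obtain k d d' where k: "k > 0" and d: "signed_positive d (B ^\<^sub>m k)"
    and d': "signed_positive d' (B ^\<^sub>m Suc k)"
    unfolding SJS_iff_signed_positive by blast
  define \<rho> where "\<rho> = spectral_radius ?B"
  have le: "cmod \<mu> \<le> \<rho>" if "eigenvalue ?B \<mu>" for \<mu>
    using spectral_radius_mem_max(2)[OF cB m, of "cmod \<mu>"] that unfolding \<rho>_def spectrum_def by blast
  obtain \<mu> where \<mu>: "eigenvalue ?B \<mu>" "cmod \<mu> = \<rho>"
    using spectral_radius_mem_max(1)[OF cB m] unfolding \<rho>_def spectrum_def by auto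
  then have \<rho>0: "0 \<le> \<rho>" using norm_ge_zero by metis
  have growth: "\<exists>b. \<forall>k. \<forall>i<m. \<forall>j<m. \<bar>(B ^\<^sub>m k) $$ (i, j)\<bar> \<le> b * r ^ k" if "\<rho> < r" for r
    by (rule pow_mat_growth[OF B]) (insert that \<rho>0 le, auto intro: le_less_trans)
  have dom: "\<mu> = of_real \<rho>" "0 < \<rho>" if ev: "eigenvalue ?B \<mu>" and c: "cmod \<mu> = \<rho>" for \<mu>
  proof -
    obtain v where v: "eigenvector ?B v \<mu>" using ev unfolding eigenvalue_def by blast
    \<comment> \<open>The signatures \<open>d\<close> and \<open>d'\<close> need not be compared:
      only the identities for \<open>\<mu> ^ k\<close> and \<open>\<mu> ^ Suc k\<close> are
      combined, and their quotient is \<open>\<mu> = \<rho>\<close>.\<close>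
    note r1 = dominant_eigenvector_signed[OF B k d v, unfolded c, OF growth]
    note r2 = dominant_eigenvector_signed[OF B zero_less_Suc d' v, unfolded c, OF growth]
    show "0 < \<rho>" by (rule r1(2))
    then have "complex_of_real (\<rho> ^ k) \<noteq> 0" by simp
    moreover have "\<mu> * of_real (\<rho> ^ k) = of_real \<rho> * of_real (\<rho> ^ k)"
      using r1(1) r2(1) by simp
    ultimately show "\<mu> = of_real \<rho>" by (metis mult_right_cancel)
  qed
  have \<rho>: "0 < \<rho>" "eigenvalue ?B (of_real \<rho>)" using dom[OF \<mu>] \<mu> by auto
  obtain x where x: "eigenvector B x \<rho>" and dx: "\<And>i. i < m \<Longrightarrow> 0 < d i * x $ i"
    using dominant_real_eigenvector_signed[OF B k d \<rho>(2) \<rho>0 growth] by blast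
  have mT: "map_mat complex_of_real ?T = transpose_mat ?B" by auto
  have "eigenvalue (map_mat complex_of_real ?T) (of_real \<rho>)"
    using \<rho>(2) cB unfolding mT
    by (metis char_poly_transpose_mat eigenvalue_root_char_poly transpose_carrier_mat)
  moreover have "signed_positive d (?T ^\<^sub>m k)"
  proof -
    obtain Q where Q: "Q = B ^\<^sub>m k" "Q \<in> carrier_mat m m" using pow_carrier_mat[OF B, of k] by blast
    have "0 < d i * d j * transpose_mat Q $$ (i, j)" if "i < m" "j < m" for i j
    proof -
      have "0 < d j * d i * Q $$ (j, i)" using d Q that unfolding signed_positive_def by auto
      then show ?thesis using Q(2) that by (simp add: mult.commute)
    qed
    then show ?thesis
      using d Q(2) unfolding pow_mat_transpose[OF B] signed_positive_def Q(1)[symmetric] by auto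
  qed
  moreover have "\<exists>b. \<forall>k. \<forall>i<m. \<forall>j<m. \<bar>(?T ^\<^sub>m k) $$ (i, j)\<bar> \<le> b * r ^ k" if r: "\<rho> < r" for r
  proof -
    have "(?T ^\<^sub>m k) $$ (i, j) = (B ^\<^sub>m k) $$ (j, i)" if "i < m" "j < m" for k i j
      unfolding pow_mat_transpose[OF B] using that carrier_matD[OF pow_carrier_mat[OF B, of k]]
      by (simp only: index_transpose_mat)
    then show ?thesis using growth[OF r] by metis
  qed
  ultimately obtain y where y: "eigenvector ?T y \<rho>" and dy: "\<And>i. i < m \<Longrightarrow> 0 < d i * y $ i"
    using dominant_real_eigenvector_signed[OF T k _ _ \<rho>0] by blast
  have xv: "x \<in> carrier_vec m" "B *\<^sub>v x = \<rho> \<cdot>\<^sub>v x" and yv: "y \<in> carrier_vec m" "?T *\<^sub>v y = \<rho> \<cdot>\<^sub>v y"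
    using x y B unfolding eigenvector_def by auto
  have d1: "d i = 1 \<or> d i = -1" if "i < m" for i
    using d that B unfolding signed_positive_def by (auto simp: abs_eq_iff')
  have sgn_eq_d: "sgn (z $ i) = d i" if "0 < d i * z $ i" "i < m" for z :: "real vec" and i
    using that d1[OF that(2)] by auto
  have SS: "Sign x = Sign y"
    unfolding Sign_def by (rule eq_vecI) (insert xv yv sgn_eq_d dx dy, auto)
  moreover have nz: "no_zero_coords x" "no_zero_coords y"
    unfolding no_zero_coords_def using dx dy xv yv by fastforce+
  \<comment> \<open>If \<open>\<rho>\<close> were not simple, deflation would give an eigenvector
    \<open>z\<close> of \<open>B\<close> with \<open>y \<bullet> z = 0\<close>. But \<open>z\<close>
    has the sign pattern \<open>d\<close> up to a phase and \<open>y\<close> has the pattern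
    \<open>d\<close>, so the pairing is a nonzero phase times a positive sum.\<close>
  moreover have "simple_eigenvalue B \<rho>"
  proof -
    have yx: "y \<bullet> x \<noteq> 0" using Sign_eq_scalar_prod_pos[OF xv(1) yv(1) m nz(1) SS] by simp
    have "\<not> eigenvalue (deflate B \<rho> x y) \<rho>"
    proof
      assume "eigenvalue (deflate B \<rho> x y) \<rho>"
      then obtain z where z: "eigenvector (deflate B \<rho> x y) z \<rho>" unfolding eigenvalue_def by blast
      have yz: "y \<bullet> z = 0" and Bz: "eigenvector B z \<rho>"
        using eigenvector_deflate[OF B xv(1) yv(1) yv(2) yx z] \<rho> by auto
      have zc: "z \<in> carrier_vec m" using Bz B unfolding eigenvector_def by auto
      have "eigenvector ?B (map_vec complex_of_real z) (of_real \<rho>)"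
        by (rule of_real_hom.eigenvector_hom[OF B Bz])
      from dominant_eigenvector_signed(3)[OF B k d this] growth \<rho>
      obtain u where u: "\<And>i. i < m \<Longrightarrow> map_vec complex_of_real z $ i \<noteq> 0 \<and>
          map_vec complex_of_real z $ i = u * of_real (d i * cmod (map_vec complex_of_real z $ i))"
        by auto
      have zi: "z $ i \<noteq> 0" "complex_of_real (z $ i) = u * of_real (d i * \<bar>z $ i\<bar>)" if "i < m" for i
        using u[OF that] zc that by auto
      have "complex_of_real (y \<bullet> z) = (\<Sum>i<m. of_real (y $ i) * complex_of_real (z $ i))"
        using zc by (simp add: scalar_prod_def lessThan_atLeast0)
      also have "\<dots> = (\<Sum>i<m. u * of_real (d i * y $ i * \<bar>z $ i\<bar>))"
      proof (rule sum.cong[OF refl])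
        fix i assume "i \<in> {..<m}"
        then have i: "i < m" by simp
        show "of_real (y $ i) * complex_of_real (z $ i) = u * of_real (d i * y $ i * \<bar>z $ i\<bar>)"
          unfolding zi(2)[OF i] by simp
      qed
      also have "\<dots> = u * of_real (\<Sum>i<m. d i * y $ i * \<bar>z $ i\<bar>)"
        by (simp add: sum_distrib_left)
      finally have "u * of_real (\<Sum>i<m. d i * y $ i * \<bar>z $ i\<bar>) = 0" using yz by simp
      moreover have "(\<Sum>i<m. d i * y $ i * \<bar>z $ i\<bar>) > 0"
        using dy zi m by (intro sum_pos) auto
      moreover have "u \<noteq> 0" using zi[OF m] by auto
      ultimately show False unfolding mult_eq_0_iff of_real_eq_0_iff by linarith
    qed
    then have "order \<rho> (char_poly B) = 1"
      using order_eq_1_iff_deflate[OF B xv(1) yv(1) xv(2) yx] \<rho> by simp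
    then show ?thesis unfolding simple_eigenvalue_def eigenvalue_def using x by blast
  qed
  moreover have "cmod \<mu> < \<rho>" if "eigenvalue ?B \<mu>" "\<mu> \<noteq> of_real \<rho>" for \<mu>
    using le[OF that(1)] dom(1)[OF that(1)] that(2) by (auto simp: less_le)
  ultimately show ?thesis unfolding signature_equality_def
    by (intro exI[of _ \<rho>] exI[of _ x] exI[of _ y] conjI allI impI \<rho>(1) x y) blast+
qed

lemma order_char_poly_of_real:
  assumes "B \<in> carrier_mat m m"
  shows "order (complex_of_real l) (char_poly (map_mat complex_of_real B)) = order l (char_poly B)"
proof -
  interpret map_poly_inj_idom_divide_hom complex_of_real ..
  show ?thesis unfolding of_real_hom.char_poly_hom[OF assms] by (rule order_hom)
qed

text \<open>The deflated matrix has all eigenvalues below \<open>l\<close> in modulus: nonzero ones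
  are eigenvalues of \<open>B\<close>, and \<open>l\<close> itself is excluded by simplicity. So its
  powers are negligible against the rank-one term, whose entries have the signs
  \<open>d i * d j\<close>.\<close>

lemma signature_equality_imp_eventually_SJS:
  fixes B :: "real mat"
  assumes B: "B \<in> carrier_mat m m" and m: "m > 0" and "signature_equality B"
  shows "eventually_SJS B"
proof -
  let ?h = "complex_of_real"
  let ?B = "map_mat ?h B"
  obtain l x y where l: "l > 0" and simple: "simple_eigenvalue B l"
    and dom: "\<And>\<mu>. eigenvalue ?B \<mu> \<Longrightarrow> \<mu> \<noteq> ?h l \<Longrightarrow> cmod \<mu> < l"
    and ex: "eigenvector B x l" and ey: "eigenvector (transpose_mat B) y l"
    and nz: "no_zero_coords x" "no_zero_coords y" and S: "Sign x = Sign y"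
    using assms(3) unfolding signature_equality_def by blast
  have x: "x \<in> carrier_vec m" "B *\<^sub>v x = l \<cdot>\<^sub>v x" and y: "y \<in> carrier_vec m" "transpose_mat B *\<^sub>v y = l \<cdot>\<^sub>v y"
    using ex ey B unfolding eigenvector_def by auto
  have yx: "y \<bullet> x > 0" by (rule Sign_eq_scalar_prod_pos[OF x(1) y(1) m nz(1) S])
  define C where "C = deflate B l x y"
  have C: "C \<in> carrier_mat m m" unfolding C_def using B x y by simp
  let ?x = "map_vec ?h x" and ?y = "map_vec ?h y"
  have cC: "map_mat ?h C = deflate ?B (?h l) ?x ?y"
    unfolding C_def by (rule map_mat_of_real_deflate[OF B x(1) y(1)])
  have cB: "?B \<in> carrier_mat m m" and cx: "?x \<in> carrier_vec m" and cy: "?y \<in> carrier_vec m"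
    using B x y by auto
  have cBx: "?B *\<^sub>v ?x = ?h l \<cdot>\<^sub>v ?x"
    using of_real_hom.eigenvector_hom[OF B ex] unfolding eigenvector_def by blast
  have cBy: "transpose_mat ?B *\<^sub>v ?y = ?h l \<cdot>\<^sub>v ?y"
  proof -
    have "map_mat ?h (transpose_mat B) = transpose_mat ?B" by auto
    then show ?thesis
      using of_real_hom.eigenvector_hom[OF transpose_carrier_mat[THEN iffD2, OF B] ey]
      unfolding eigenvector_def by metis
  qed
  have cyx: "?y \<bullet> ?x \<noteq> 0"
  proof -
    have "?y \<bullet> ?x = ?h (y \<bullet> x)" using x y by (simp add: scalar_prod_def)
    then show ?thesis using yx by simp
  qed
  have spec: "cmod \<mu> < l" if ev: "eigenvalue (map_mat ?h C) \<mu>" for \<mu>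
  proof (cases "\<mu> = 0")
    case False
    obtain v where "eigenvector (deflate ?B (?h l) ?x ?y) v \<mu>"
      using ev unfolding cC eigenvalue_def by blast
    from eigenvector_deflate(2)[OF cB cx cy cBy cyx this False]
    have "eigenvalue ?B \<mu>" unfolding eigenvalue_def by blast
    moreover have "\<mu> \<noteq> ?h l"
    proof
      assume "\<mu> = ?h l"
      then have "order (?h l) (char_poly ?B) \<noteq> 1"
        using order_eq_1_iff_deflate[OF cB cx cy cBx cyx] ev l unfolding cC by simp
      then show False using simple unfolding order_char_poly_of_real[OF B] simple_eigenvalue_def by simp
    qed
    ultimately show ?thesis by (rule dom)
  qed (use l in simp)
  have cCc: "map_mat ?h C \<in> carrier_mat m m" using C by simp
  \<comment> \<open>The midpoint lies strictly above the spectral radius, for the growth bound, and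
    strictly below \<open>l\<close>, so that \<open>(r / l) ^ k\<close> tends to zero.\<close>
  define r where "r = (spectral_radius (map_mat ?h C) + l) / 2"
  have sr: "spectral_radius (map_mat ?h C) < l" "0 \<le> spectral_radius (map_mat ?h C)"
    using spectral_radius_mem_max(1)[OF cCc m] spec unfolding spectrum_def by auto
  have r: "spectral_radius (map_mat ?h C) < r" "r < l" "0 < r"
    using sr l unfolding r_def by auto
  obtain b where b: "\<And>k i j. i < m \<Longrightarrow> j < m \<Longrightarrow> \<bar>(C ^\<^sub>m k) $$ (i, j)\<bar> \<le> b * r ^ k"
  proof -
    have "cmod \<mu> < r" if "eigenvalue (map_mat ?h C) \<mu>" for \<mu>
      using spectral_radius_mem_max(2)[OF cCc m, of "cmod \<mu>"] that r(1) unfolding spectrum_def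
      by (auto intro: le_less_trans)
    from pow_mat_growth[OF C r(3) this] show ?thesis using that by blast
  qed
  define d where "d i = sgn (x $ i)" for i
  have xi: "x $ i \<noteq> 0" "y $ i \<noteq> 0" if "i < m" for i
    using nz that x y unfolding no_zero_coords_def by auto
  have d1: "\<bar>d i\<bar> = 1" if "i < m" for i using xi[OF that] unfolding d_def by (simp add: abs_sgn_eq)
  have dx: "d i * x $ i = \<bar>x $ i\<bar>" "d i * y $ i = \<bar>y $ i\<bar>" if "i < m" for i
    using Sign_eq_sgn[OF S x(1) y(1) that] unfolding d_def by (auto simp: sgn_if abs_if split: if_splits)
  have lim: "(\<lambda>k. b * (r / l) ^ k) \<longlonglongrightarrow> 0"
    using r l by (intro tendsto_mult_right_zero LIMSEQ_realpow_zero) auto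
  have "\<forall>\<^sub>F k in sequentially. \<forall>i\<in>{..<m}. \<forall>j\<in>{..<m}. b * (r / l) ^ k < \<bar>x $ i\<bar> * \<bar>y $ j\<bar> / (y \<bullet> x)"
    using xi yx by (intro eventually_ball_finite ballI order_tendstoD(2)[OF lim]) auto
  then obtain k0 where k0: "\<And>k i j. k \<ge> k0 \<Longrightarrow> i < m \<Longrightarrow> j < m \<Longrightarrow>
      b * (r / l) ^ k < \<bar>x $ i\<bar> * \<bar>y $ j\<bar> / (y \<bullet> x)"
    unfolding eventually_sequentially by auto
  \<comment> \<open>The shift by one keeps the exponent positive, where the powers split.\<close>
  have "SJS (B ^\<^sub>m k)" if k: "k \<ge> Suc k0" for k
  proof -
    have "0 < d i * d j * (B ^\<^sub>m k) $$ (i, j)" if ij: "i < m" "j < m" for i j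
    proof -
      obtain k' where k': "k = Suc k'" using k by (cases k) auto
      have "B ^\<^sub>m k = C ^\<^sub>m k + (l ^ k / (y \<bullet> x)) \<cdot>\<^sub>m outer_prod x y"
        unfolding k' C_def using pow_mat_deflate[OF B x(1) y(1) x(2) y(2)] yx by simp
      then have "(B ^\<^sub>m k) $$ (i, j) = (C ^\<^sub>m k) $$ (i, j) + l ^ k / (y \<bullet> x) * (x $ i * y $ j)"
        using x y ij by (simp add: outer_prod_def)
      then have "d i * d j * (B ^\<^sub>m k) $$ (i, j)
          = d i * d j * (C ^\<^sub>m k) $$ (i, j) + l ^ k / (y \<bullet> x) * ((d i * x $ i) * (d j * y $ j))"
        by (simp add: algebra_simps)
      also have "\<dots> = d i * d j * (C ^\<^sub>m k) $$ (i, j) + l ^ k * (\<bar>x $ i\<bar> * \<bar>y $ j\<bar> / (y \<bullet> x))"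
        using dx ij by simp
      finally have eq: "d i * d j * (B ^\<^sub>m k) $$ (i, j)
          = d i * d j * (C ^\<^sub>m k) $$ (i, j) + l ^ k * (\<bar>x $ i\<bar> * \<bar>y $ j\<bar> / (y \<bullet> x))" .
      have "\<bar>d i * d j * (C ^\<^sub>m k) $$ (i, j)\<bar> \<le> b * r ^ k"
        using b[OF ij] d1 ij by (simp add: abs_mult)
      moreover have "b * r ^ k = l ^ k * (b * (r / l) ^ k)"
        using l by (simp add: power_divide)
      moreover have "l ^ k * (b * (r / l) ^ k) < l ^ k * (\<bar>x $ i\<bar> * \<bar>y $ j\<bar> / (y \<bullet> x))"
        using k0[OF _ ij, of k] k l by (intro mult_strict_left_mono) auto
      ultimately show ?thesis unfolding eq by linarith
    qed
    then have "signed_positive d (B ^\<^sub>m k)"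
      unfolding signed_positive_def using d1 carrier_matD[OF pow_carrier_mat[OF B, of k]] by metis
    then show ?thesis unfolding SJS_iff_signed_positive by blast
  qed
  then show ?thesis unfolding eventually_SJS_def by blast
qed

subsection \<open>Exterior products\<close>

lemma det_scale_columns:
  fixes F :: "nat \<Rightarrow> nat \<Rightarrow> 'a :: comm_ring_1"
  shows "det (mat j j (\<lambda>(r, s). c s * F r s)) = (\<Prod>i<j. c i) * det (mat j j (\<lambda>(r, s). F r s))"
proof -
  have "signof p * (\<Prod>i = 0..<j. mat j j (\<lambda>(r, s). c s * F r s) $$ (i, p i))
      = (\<Prod>i<j. c i) * (signof p * (\<Prod>i = 0..<j. mat j j (\<lambda>(r, s). F r s) $$ (i, p i)))"
    if p: "p permutes {0..<j}" for p
  proof -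
    have pj: "p i < j" if "i < j" for i using permutes_in_image[OF p, of i] that by auto
    have "(\<Prod>i = 0..<j. mat j j (\<lambda>(r, s). c s * F r s) $$ (i, p i))
        = (\<Prod>i = 0..<j. c (p i)) * (\<Prod>i = 0..<j. mat j j (\<lambda>(r, s). F r s) $$ (i, p i))"
      unfolding prod.distrib[symmetric] using pj by (intro prod.cong) auto
    also have "(\<Prod>i = 0..<j. c (p i)) = (\<Prod>i<j. c i)"
      using prod.permute[OF p, of c] by (simp add: comp_def lessThan_atLeast0)
    finally show ?thesis by (simp add: ac_simps)
  qed
  then show ?thesis
    by (subst (1 2) det_def'[of _ j]) (auto simp: sum_distrib_left intro!: sum.cong)
qed

lemma dim_ext_prod [simp]: "dim_vec (ext_prod n xs) = n choose length xs"
  unfolding ext_prod_def by (simp add: Let_def)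

lemma ext_prod_index:
  "a < n choose j \<Longrightarrow> ext_prod n (map x [0..<j]) $ a
    = det (mat j j (\<lambda>(r, s). x s $ (index_sets n j ! a ! r)))"
  unfolding ext_prod_def Let_def
  by (auto intro!: arg_cong[where f = det])

text \<open>Brings wedges within reach of Cauchy--Binet. The width \<open>k\<close> is
  \<open>j\<close> when a compound acts on a wedge, and \<open>n\<close> when the wedge is read as a
  column of the compound of the full eigenvector matrix.\<close>

lemma ext_prod_eq_minor:
  assumes "j \<le> k" "a < n choose j"
  shows "ext_prod n (map x [0..<j]) $ a = minor (mat n k (\<lambda>(r, s). x s $ r)) (index_sets n j ! a) [0..<j]"
proof -
  note D = increasing_listsD[OF index_sets_nth_in[OF assms(2)]]
  show ?thesis
    unfolding ext_prod_index[OF assms(2)] minor_def D(1)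
    by (rule arg_cong[where f = det]) (insert assms D, auto)
qed

lemma ext_prod_scale:
  assumes "\<And>i. i < j \<Longrightarrow> x i \<in> carrier_vec n"
  shows "ext_prod n (map (\<lambda>i. c i \<cdot>\<^sub>v x i) [0..<j]) = (\<Prod>i<j. c i) \<cdot>\<^sub>v ext_prod n (map x [0..<j])"
proof (rule eq_vecI)
  fix a assume "a < dim_vec ((\<Prod>i<j. c i) \<cdot>\<^sub>v ext_prod n (map x [0..<j]))"
  then have a: "a < n choose j" by simp
  note D = increasing_listsD[OF index_sets_nth_in[OF a]]
  let ?I = "index_sets n j ! a"
  have "mat j j (\<lambda>(r, s). (c s \<cdot>\<^sub>v x s) $ (?I ! r)) = mat j j (\<lambda>(r, s). c s * x s $ (?I ! r))"
    by (rule eq_matI) (insert D, auto simp: carrier_vecD[OF assms])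
  then have "ext_prod n (map (\<lambda>i. c i \<cdot>\<^sub>v x i) [0..<j]) $ a = det (mat j j (\<lambda>(r, s). c s * x s $ (?I ! r)))"
    unfolding ext_prod_index[OF a] by simp
  also have "\<dots> = (\<Prod>i<j. c i) * ext_prod n (map x [0..<j]) $ a"
    unfolding ext_prod_index[OF a] by (rule det_scale_columns)
  finally show "ext_prod n (map (\<lambda>i. c i \<cdot>\<^sub>v x i) [0..<j]) $ a
      = ((\<Prod>i<j. c i) \<cdot>\<^sub>v ext_prod n (map x [0..<j])) $ a" using a by simp
qed simp

text \<open>Cauchy--Binet with the vectors as columns of the right factor: the compound is the
  exterior power of the linear map.\<close>

lemma compound_mat_mult_ext_prod:
  assumes A: "A \<in> carrier_mat n n" and x: "\<And>i. i < j \<Longrightarrow> x i \<in> carrier_vec n"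
  shows "compound_mat A j *\<^sub>v ext_prod n (map x [0..<j]) = ext_prod n (map (\<lambda>i. A *\<^sub>v x i) [0..<j])"
proof (rule eq_vecI)
  fix a assume "a < dim_vec (ext_prod n (map (\<lambda>i. A *\<^sub>v x i) [0..<j]))"
  then have a: "a < n choose j" by simp
  let ?I = "index_sets n j" and ?M = "mat n j (\<lambda>(r, s). x s $ r)"
  have M: "?M \<in> carrier_mat n j" by simp
  note D = increasing_listsD[OF index_sets_nth_in[OF a]]
  have ext: "ext_prod n (map x [0..<j]) \<in> carrier_vec (n choose j)" by (auto intro!: carrier_vecI)
  have "(compound_mat A j *\<^sub>v ext_prod n (map x [0..<j])) $ a
      = (\<Sum>b<n choose j. minor A (?I ! a) (?I ! b) * minor ?M (?I ! b) [0..<j])"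
    unfolding mult_mat_vec_index_sum[OF compound_mat_carrier[OF A] ext a]
    by (rule sum.cong) (insert a, auto simp: compound_mat_index[OF A] ext_prod_eq_minor[of j j])
  also have "\<dots> = (\<Sum>K\<in>increasing_lists n j. minor A (?I ! a) K * minor ?M K [0..<j])"
    by (rule sum_increasing_lists[symmetric])
  also have "\<dots> = minor (A * ?M) (?I ! a) [0..<j]"
    by (rule minor_mult[OF A M, symmetric])
       (insert index_sets_nth_in[OF a], auto simp: increasing_lists_def)
  also have "A * ?M = mat n j (\<lambda>(r, s). (A *\<^sub>v x s) $ r)"
    by (rule eq_matI) (insert A, auto simp: scalar_prod_def carrier_vecD[OF x])
  also have "minor \<dots> (?I ! a) [0..<j] = ext_prod n (map (\<lambda>i. A *\<^sub>v x i) [0..<j]) $ a"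
    by (rule ext_prod_eq_minor[symmetric]) (insert a, auto)
  finally show "(compound_mat A j *\<^sub>v ext_prod n (map x [0..<j])) $ a
      = ext_prod n (map (\<lambda>i. A *\<^sub>v x i) [0..<j]) $ a" .
qed (insert carrier_matD[OF compound_mat_carrier[OF A, of j]], simp)

text \<open>Applying \<open>A - t\<close> to a linear relation among the eigenvectors multiplies
  coefficient \<open>i\<close> by \<open>l i - t\<close>. Doing so for all \<open>t = l k\<close>
  with \<open>k\<close> other than \<open>h\<close> leaves only term \<open>h\<close>, whose
  coefficient is then zero.\<close>

lemma det_distinct_eigenvectors:
  fixes A :: "real mat"
  assumes A: "A \<in> carrier_mat n n" and ev: "\<And>i. i < n \<Longrightarrow> eigenvector A (x i) (l i)"
    and inj: "inj_on l {..<n}"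
  shows "det (mat n n (\<lambda>(r, s). x s $ r)) \<noteq> 0"
proof
  let ?M = "mat n n (\<lambda>(r, s). x s $ r)"
  assume "det ?M = 0"
  then obtain v where v: "v \<in> carrier_vec n" "v \<noteq> 0\<^sub>v n" "?M *\<^sub>v v = 0\<^sub>v n"
    using det_0_iff_vec_prod_zero[of ?M n] by auto
  have x: "x i \<in> carrier_vec n" "x i \<noteq> 0\<^sub>v n" "A *\<^sub>v x i = l i \<cdot>\<^sub>v x i" if "i < n" for i
    using ev[OF that] A unfolding eigenvector_def by auto
  have Ax: "(\<Sum>q<n. A $$ (r, q) * x i $ q) = l i * x i $ r" if "i < n" "r < n" for i r
    using mult_mat_vec_index_sum[OF A x(1)[OF that(1)] that(2)] x[OF that(1)] that by simp
  define relation where "relation c \<longleftrightarrow> (\<forall>r<n. (\<Sum>i<n. c i * x i $ r) = 0)" for c :: "nat \<Rightarrow> real"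
  have v0: "relation (\<lambda>i. v $ i)" unfolding relation_def
  proof (intro allI impI)
    fix r assume r: "r < n"
    have "(?M *\<^sub>v v) $ r = (\<Sum>i<n. x i $ r * v $ i)"
      using mult_mat_vec_index_sum[of ?M n n v r] v r by simp
    then show "(\<Sum>i<n. v $ i * x i $ r) = 0" using v r by (simp add: mult.commute)
  qed
  have step: "relation (\<lambda>i. (l i - t) * c i)" if c: "relation c" for c t
    unfolding relation_def
  proof (intro allI impI)
    fix r assume r: "r < n"
    have "0 = (\<Sum>q<n. A $$ (r, q) * (\<Sum>i<n. c i * x i $ q))"
      using c unfolding relation_def by simp
    also have "\<dots> = (\<Sum>q<n. \<Sum>i<n. c i * (A $$ (r, q) * x i $ q))"
      by (simp add: sum_distrib_left ac_simps)
    also have "\<dots> = (\<Sum>i<n. \<Sum>q<n. c i * (A $$ (r, q) * x i $ q))" by (rule sum.swap)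
    also have "\<dots> = (\<Sum>i<n. c i * (l i * x i $ r))"
      unfolding sum_distrib_left[symmetric] using Ax[OF _ r] by (intro sum.cong) auto
    finally have "(\<Sum>i<n. c i * (l i * x i $ r)) = 0" by simp
    moreover have "(\<Sum>i<n. t * (c i * x i $ r)) = 0"
      using c r unfolding relation_def sum_distrib_left[symmetric] by simp
    moreover have "(\<Sum>i<n. (l i - t) * c i * x i $ r)
        = (\<Sum>i<n. c i * (l i * x i $ r)) - (\<Sum>i<n. t * (c i * x i $ r))"
      unfolding sum_subtractf[symmetric] by (simp add: algebra_simps)
    ultimately show "(\<Sum>i<n. (l i - t) * c i * x i $ r) = 0" by simp
  qed
  have prod: "relation (\<lambda>i. (\<Prod>k\<in>S. l i - l k) * v $ i)" if "finite S" for S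
    using that
  proof (induction S)
    case empty
    then show ?case using v0 by simp
  next
    case (insert k S)
    from step[OF insert.IH, of "l k"] show ?case using insert.hyps by (simp add: mult.assoc)
  qed
  obtain h where h: "h < n" "v $ h \<noteq> 0" using v by (auto simp: vec_eq_iff)
  obtain r where r: "r < n" "x h $ r \<noteq> 0" using x[OF h(1)] by (auto simp: vec_eq_iff)
  let ?S = "{..<n} - {h}"
  have "0 = (\<Sum>i<n. (\<Prod>k\<in>?S. l i - l k) * v $ i * x i $ r)"
    using prod[of ?S] r unfolding relation_def by simp
  also have "\<dots> = (\<Sum>i\<in>{h}. (\<Prod>k\<in>?S. l i - l k) * v $ i * x i $ r)"
  proof (rule sum.mono_neutral_right)
    show "\<forall>i\<in>{..<n} - {h}. (\<Prod>k\<in>?S. l i - l k) * v $ i * x i $ r = 0"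
    proof
      fix i assume "i \<in> {..<n} - {h}"
      then have "(\<Prod>k\<in>?S. l i - l k) = 0" by (intro prod_zero) auto
      then show "(\<Prod>k\<in>?S. l i - l k) * v $ i * x i $ r = 0" by simp
    qed
  qed (use h in auto)
  finally have "(\<Prod>k\<in>?S. l h - l k) = 0" using h r by simp
  then show False using inj h by (auto simp: inj_on_def)
qed

lemma ext_prod_eigenvector:
  fixes A :: "real mat"
  assumes A: "A \<in> carrier_mat n n" and ev: "\<And>i. i < n \<Longrightarrow> eigenvector A (x i) (l i)"
    and inj: "inj_on l {..<n}" and j: "j \<le> n"
  shows "eigenvector (compound_mat A j) (ext_prod n (map x [0..<j])) (\<Prod>i<j. l i)"
proof -
  let ?e = "ext_prod n (map x [0..<j])" and ?M = "mat n n (\<lambda>(r, s). x s $ r)"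
  have x: "x i \<in> carrier_vec n" "A *\<^sub>v x i = l i \<cdot>\<^sub>v x i" if "i < n" for i
    using ev[OF that] A unfolding eigenvector_def by auto
  have C: "compound_mat A j \<in> carrier_mat (n choose j) (n choose j)" using A by simp
  have "map (\<lambda>i. A *\<^sub>v x i) [0..<j] = map (\<lambda>i. l i \<cdot>\<^sub>v x i) [0..<j]" using x j by simp
  then have "compound_mat A j *\<^sub>v ?e = (\<Prod>i<j. l i) \<cdot>\<^sub>v ?e"
    using compound_mat_mult_ext_prod[OF A, of j x] ext_prod_scale[of j x n l] x j
    by (metis less_le_trans)
  \<comment> \<open>A vanishing wedge would be a zero column, at the index set
    \<open>[0..<j]\<close>, of the compound of \<open>?M\<close>; but this compound inherits
    invertibility from \<open>?M\<close>.\<close>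
  moreover have "?e \<noteq> 0\<^sub>v (n choose j)"
  proof
    assume e0: "?e = 0\<^sub>v (n choose j)"
    have M: "?M \<in> carrier_mat n n" by simp
    obtain N where N: "N \<in> carrier_mat n n" "N * ?M = 1\<^sub>m n"
      using det_non_zero_imp_unit[OF M det_distinct_eigenvectors[OF A ev inj], of "()"]
      unfolding Units_def ring_mat_def by auto
    have "[0..<j] \<in> set (index_sets n j)"
      unfolding set_index_sets by (rule upt_in_increasing_lists[OF j])
    then obtain c where c: "c < n choose j" "index_sets n j ! c = [0..<j]"
      by (metis in_set_conv_nth length_index_sets)
    have NM: "compound_mat N j * compound_mat ?M j = 1\<^sub>m (n choose j)"
      using compound_mat_mult[OF N(1) M] N(2) by (simp add: compound_mat_one)
    have z: "compound_mat ?M j $$ (b, c) = 0" if b: "b < n choose j" for b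
      using ext_prod_eq_minor[OF j b, of x] compound_mat_index[OF M b c(1)] c(2) e0 b by simp
    have "(compound_mat N j * compound_mat ?M j) $$ (c, c) = 0"
      using c z carrier_matD[OF compound_mat_carrier[OF N(1), of j]] carrier_matD[OF compound_mat_carrier[OF M, of j]]
      by (auto simp: scalar_prod_def intro!: sum.neutral)
    then show False unfolding NM using c by simp
  qed
  ultimately show ?thesis
    unfolding eigenvector_def using carrier_matD[OF C] by (auto intro!: carrier_vecI)
qed

subsection \<open>Dominant products of eigenvalues\<close>

lemma prod_strict_mono_ex1:
  fixes f g :: "'b \<Rightarrow> real"
  assumes "finite S" "\<And>i. i \<in> S \<Longrightarrow> 0 < f i \<and> f i \<le> g i" "k \<in> S" "f k < g k"
  shows "prod f S < prod g S"
proof -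
  have "prod f (S - {k}) \<le> prod g (S - {k})" using assms by (intro prod_mono) (auto simp: less_imp_le)
  moreover have "0 < prod f (S - {k})" using assms by (intro prod_pos) auto
  ultimately have "f k * prod f (S - {k}) < g k * prod g (S - {k})"
    using assms by (intro mult_less_le_imp_less) (auto simp: less_imp_le)
  then show ?thesis using assms(1,3) by (simp add: prod.remove)
qed

lemma prod_list_increasing:
  "K \<in> increasing_lists n j \<Longrightarrow> (\<Prod>i\<leftarrow>K. f i) = (\<Prod>r<j. f (K ! r))"
  using increasing_listsD(1)[of K n j]
  by (simp add: prod.list_conv_set_nth lessThan_atLeast0)

lemma increasing_lists_neq_upt:
  assumes K: "K \<in> increasing_lists n j" and "K \<noteq> [0..<j]"
  shows "\<exists>r<j. r < K ! r"
proof (rule ccontr)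
  assume "\<not> ?thesis"
  then have "K ! r = r" if "r < j" for r using increasing_lists_nth_ge[OF K that] that by force
  then have "K = [0..<j]" using increasing_listsD(1)[OF K] by (intro nth_equalityI) auto
  then show False using assms by simp
qed

lemma order_prod_linear:
  fixes e :: "'b \<Rightarrow> 'a :: field"
  assumes "distinct Is"
  shows "order c (\<Prod>I\<leftarrow>Is. [:- e I, 1:]) = card {I \<in> set Is. e I = c}"
proof -
  have "order c (\<Prod>I\<leftarrow>Is. [:- e I, 1:]) = (\<Sum>I\<leftarrow>Is. order c [:- e I, 1:])"
    by (subst order_prod_list) (auto simp: comp_def)
  also have "\<dots> = (\<Sum>I\<in>set Is. if e I = c then 1 else 0)"
    unfolding sum_list_distinct_conv_sum_set[OF assms] by (rule sum.cong) (auto simp: order_linear')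
  also have "\<dots> = card {I \<in> set Is. e I = c}"
    by (simp add: sum.If_cases Collect_conj_eq Int_commute)
  finally show ?thesis .
qed

lemma poly_prod_linear_eq_0_iff:
  fixes e :: "'b \<Rightarrow> 'a :: idom"
  shows "poly (\<Prod>I\<leftarrow>Is. [:- e I, 1:]) c = 0 \<longleftrightarrow> (\<exists>I\<in>set Is. e I = c)"
  by (induction Is) auto

lemma map_poly_of_real_prod_linear:
  "map_poly complex_of_real (\<Prod>I\<leftarrow>Is. [:- e I, 1:]) = (\<Prod>I\<leftarrow>Is. [:- complex_of_real (e I), 1:])"
proof (induction Is)
  case (Cons I Is)
  interpret map_poly_inj_idom_divide_hom complex_of_real ..
  show ?case using Cons by (simp add: hom_mult del: mult_pCons_left)
qed simp

text \<open>The difference of \<open>v\<close> and its multiple of \<open>x\<close> is annihilated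
  by \<open>y\<close>. Were it nonzero, it would be an eigenvector of the deflated matrix for
  \<open>l\<close>, against simplicity.\<close>

lemma simple_eigenvector_unique:
  fixes B :: "real mat"
  assumes B: "B \<in> carrier_mat m m" and x: "x \<in> carrier_vec m" and y: "y \<in> carrier_vec m"
    and Bx: "B *\<^sub>v x = l \<cdot>\<^sub>v x" and yx: "y \<bullet> x \<noteq> 0" and l: "l \<noteq> 0"
    and simple: "order l (char_poly B) = 1"
    and v: "v \<in> carrier_vec m" "B *\<^sub>v v = l \<cdot>\<^sub>v v"
  shows "v = ((y \<bullet> v) / (y \<bullet> x)) \<cdot>\<^sub>v x"
proof (rule ccontr)
  let ?c = "(y \<bullet> v) / (y \<bullet> x)"
  let ?z = "v - ?c \<cdot>\<^sub>v x"
  assume "v \<noteq> ?c \<cdot>\<^sub>v x"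
  then have "?z \<noteq> 0\<^sub>v m" using v x by (auto simp: vec_eq_iff)
  have cx: "?c \<cdot>\<^sub>v x \<in> carrier_vec m" and z: "?z \<in> carrier_vec m" using x v by auto
  have yz: "y \<bullet> ?z = 0"
    using scalar_prod_minus_distrib[OF y v(1) cx] y x yx by simp
  have "B *\<^sub>v ?z = l \<cdot>\<^sub>v ?z"
    using mult_minus_distrib_mat_vec[OF B v(1) cx] mult_mat_vec[OF B x] x v
    unfolding Bx v(2) by (auto simp: vec_eq_iff algebra_simps)
  then have "deflate B l x y *\<^sub>v ?z = l \<cdot>\<^sub>v ?z"
    unfolding deflate_mult_vec[OF B x y z] yz using x z by (auto simp: vec_eq_iff)
  then have "eigenvalue (deflate B l x y) l"
    unfolding eigenvalue_def eigenvector_def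
    using \<open>?z \<noteq> 0\<^sub>v m\<close> z carrier_matD[OF deflate_carrier[OF B x y]] by metis
  then show False using order_eq_1_iff_deflate[OF B x y Bx yx l] simple by simp
qed

text \<open>The strict order of the eigenvalues singles out the top product: any index set other
  than \<open>[0..<j]\<close> is entrywise at least as large and somewhere larger, so some factor is
  replaced by a smaller one and none by a larger one.\<close>

lemma total_signature_equality_imp_compound:
  fixes A :: "real mat"
  assumes A: "A \<in> carrier_mat n n" and "total_signature_equality A" and j: "j \<in> {1..n}"
  shows "signature_equality (compound_mat A j)"
proof -
  have dA: "dim_row A = n" using A by simp
  obtain l x y where
    ev: "\<forall>i<n. simple_eigenvalue A (l i) \<and> l i > 0 \<and>
      eigenvector A (x i) (l i) \<and> eigenvector (transpose_mat A) (y i) (l i)"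
    and dec': "\<forall>i j. i < j \<and> j < n \<longrightarrow> l i > l j"
    and "\<forall>j\<in>{1..n}. no_zero_coords (ext_prod n (map x [0..<j])) \<and>
      no_zero_coords (ext_prod n (map y [0..<j])) \<and>
      Sign (ext_prod n (map x [0..<j])) = Sign (ext_prod n (map y [0..<j]))"
    using assms(2) unfolding total_signature_equality_def Let_def dA by (elim exE conjE)
  from this(3) j have sign: "no_zero_coords (ext_prod n (map x [0..<j]))"
    "no_zero_coords (ext_prod n (map y [0..<j]))"
    "Sign (ext_prod n (map x [0..<j])) = Sign (ext_prod n (map y [0..<j]))"
    by blast+
  have dec: "l j < l i" if "i < j" "j < n" for i j using dec' that by blast
  have inj: "inj_on l {..<n}"
    by (rule linorder_inj_onI) (auto dest: dec)
  have evx: "\<And>i. i < n \<Longrightarrow> eigenvector A (x i) (l i)"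
    and evy: "\<And>i. i < n \<Longrightarrow> eigenvector (transpose_mat A) (y i) (l i)" using ev by auto
  have x: "x i \<in> carrier_vec n" "A *\<^sub>v x i = l i \<cdot>\<^sub>v x i" if "i < n" for i
    using evx[OF that] A unfolding eigenvector_def by auto
  \<comment> \<open>The columns are the eigenvectors by decreasing eigenvalue, so \<open>A\<close>
    is similar to a real diagonal matrix that is already sorted.\<close>
  let ?M = "mat n n (\<lambda>(r, s). x s $ r)"
  define D where "D = mat n n (\<lambda>(i, k). if i = k then l i else 0)"
  have M: "?M \<in> carrier_mat n n" and D: "D \<in> carrier_mat n n" unfolding D_def by auto
  obtain N where N: "N \<in> carrier_mat n n" "N * ?M = 1\<^sub>m n" "?M * N = 1\<^sub>m n"
    using det_non_zero_imp_unit[OF M det_distinct_eigenvectors[OF A evx inj], of "()"]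
    unfolding Units_def ring_mat_def by auto
  have "A * ?M = ?M * D"
  proof (rule eq_matI)
    fix r s assume "r < dim_row (?M * D)" "s < dim_col (?M * D)"
    then have rs: "r < n" "s < n" using D by auto
    have "(A * ?M) $$ (r, s) = (A *\<^sub>v x s) $ r"
      using A rs x(1)[OF rs(2)] by (auto simp: scalar_prod_def)
    also have "\<dots> = l s * x s $ r" using x[OF rs(2)] rs by simp
    also have "\<dots> = (?M * D) $$ (r, s)"
      using rs D by (auto simp: scalar_prod_def D_def if_distrib cong: if_cong)
    finally show "(A * ?M) $$ (r, s) = (?M * D) $$ (r, s)" .
  qed (insert A D, auto)
  then have "A = ?M * D * N"
    using assoc_mult_mat[OF A M N(1)] N(3) A by simp
  then have sim: "similar_mat A D"
    unfolding similar_mat_def using similar_mat_witI[OF N(3) N(2) _ A D M N(1)] by blast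
  have "upper_triangular D" unfolding upper_triangular_def D_def by auto
  note cp = char_poly_compound_mat[OF A sim this, of j]
  define e where "e I = (\<Prod>i\<leftarrow>I. D $$ (i, i))" for I
  let ?B = "compound_mat A j" and ?E = "\<Prod>i<j. l i"
  have B: "?B \<in> carrier_mat (n choose j) (n choose j)" using A by simp
  have eI: "e I = (\<Prod>r<j. l (I ! r))" if I: "I \<in> increasing_lists n j" for I
    unfolding e_def prod_list_increasing[OF I] using increasing_listsD(4)[OF I]
    by (intro prod.cong) (auto simp: D_def)
  have jn: "j \<le> n" using j by simp
  have e0: "e [0..<j] = ?E" using eI[OF upt_in_increasing_lists[OF jn]] by simp
  have lpos: "0 < l i" if "i < n" for i using ev that by blast
  have epos: "0 < e I" if I: "I \<in> increasing_lists n j" for I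
    unfolding eI[OF I] using lpos increasing_listsD(4)[OF I] by (intro prod_pos) auto
  have eless: "e I < ?E" if I: "I \<in> increasing_lists n j" and ne: "I \<noteq> [0..<j]" for I
  proof -
    obtain r where r: "r < j" "r < I ! r" using increasing_lists_neq_upt[OF I ne] by blast
    show ?thesis unfolding eI[OF I]
    proof (rule prod_strict_mono_ex1[of _ _ _ r])
      fix s assume "s \<in> {..<j}"
      then have s: "s < j" by simp
      have "l (I ! s) \<le> l s"
        using increasing_lists_nth_ge[OF I s] increasing_listsD(4)[OF I s] dec[of s "I ! s"]
        by (cases "s = I ! s") (auto simp: less_imp_le)
      then show "0 < l (I ! s) \<and> l (I ! s) \<le> l s"
        using lpos increasing_listsD(4)[OF I s] by simp
    qed (use r dec increasing_listsD(4)[OF I r(1)] in auto)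
  qed
  have "{I \<in> set (index_sets n j). e I = ?E} = {[0..<j]}"
    unfolding set_index_sets using eless e0 upt_in_increasing_lists[OF jn] by force
  then have ord: "order ?E (char_poly ?B) = 1"
    unfolding cp e_def[symmetric] order_prod_linear[OF distinct_index_sets] by simp
  have evX: "eigenvector ?B (ext_prod n (map x [0..<j])) ?E"
    by (rule ext_prod_eigenvector[OF A evx inj jn])
  have evY: "eigenvector (transpose_mat ?B) (ext_prod n (map y [0..<j])) ?E"
    unfolding compound_mat_transpose[OF A, symmetric]
    using ext_prod_eigenvector[OF _ evy inj jn] A by simp
  have dom: "cmod \<mu> < ?E" if "eigenvalue (map_mat complex_of_real ?B) \<mu>" "\<mu> \<noteq> of_real ?E" for \<mu>
  proof -
    have "poly (char_poly (map_mat complex_of_real ?B)) \<mu> = 0"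
      using that(1) eigenvalue_root_char_poly[of "map_mat complex_of_real ?B"] B by auto
    then obtain I where I: "I \<in> increasing_lists n j" "complex_of_real (e I) = \<mu>"
      unfolding of_real_hom.char_poly_hom[OF B] cp e_def[symmetric] map_poly_of_real_prod_linear
        poly_prod_linear_eq_0_iff set_index_sets by blast
    then have "I \<noteq> [0..<j]" using that(2) e0 by auto
    then show ?thesis using eless[OF I(1)] epos[OF I(1)] I(2) by auto
  qed
  have "0 < ?E" using epos[OF upt_in_increasing_lists[OF jn]] e0 by simp
  moreover have "simple_eigenvalue ?B ?E"
    unfolding simple_eigenvalue_def eigenvalue_def using evX ord by blast
  ultimately show ?thesis
    unfolding signature_equality_def
    by (intro exI[of _ ?E] exI[of _ "ext_prod n (map x [0..<j])"] exI[of _ "ext_prod n (map y [0..<j])"]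
        conjI allI impI evX evY sign dom) blast+
qed

text \<open>By the sorting, \<open>[0..<j]\<close> gives a product of largest modulus, hence of
  modulus at least \<open>l\<close>, and dominance leaves only the value \<open>l\<close> for it.
  Simplicity of \<open>l\<close> means that no second index set has this product, so all others fall
  under the strict bound.\<close>

lemma signature_equality_compound_dominant:
  fixes A :: "real mat" and T :: "complex mat"
  assumes A: "A \<in> carrier_mat n n" and sim: "similar_mat (map_mat complex_of_real A) T"
    and ut: "upper_triangular T"
    and dec: "\<And>i k. i \<le> k \<Longrightarrow> k < n \<Longrightarrow> cmod (T $$ (k, k)) \<le> cmod (T $$ (i, i))"
    and j: "j \<le> n"
    and l: "simple_eigenvalue (compound_mat A j) l"
    and dom: "\<And>\<mu>. eigenvalue (map_mat complex_of_real (compound_mat A j)) \<mu> \<Longrightarrow> \<mu> \<noteq> of_real l \<Longrightarrow> cmod \<mu> < l"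
  shows "(\<Prod>i<j. T $$ (i, i)) = of_real l"
    and "\<And>I. I \<in> increasing_lists n j \<Longrightarrow> I \<noteq> [0..<j] \<Longrightarrow> cmod (\<Prod>i\<leftarrow>I. T $$ (i, i)) < l"
proof -
  let ?h = "complex_of_real" and ?B = "compound_mat A j"
  have B: "?B \<in> carrier_mat (n choose j) (n choose j)" using A by simp
  have cA: "map_mat ?h A \<in> carrier_mat n n" using A by simp
  have cB: "map_mat ?h ?B \<in> carrier_mat (n choose j) (n choose j)" using B by simp
  define e where "e I = (\<Prod>i\<leftarrow>I. T $$ (i, i))" for I
  have cp: "char_poly (map_mat ?h ?B) = (\<Prod>I\<leftarrow>index_sets n j. [:- e I, 1:])"
    using char_poly_compound_mat[OF cA sim ut, of j] of_real_hom.compound_mat_hom[OF A, of j]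
    unfolding e_def by metis
  have ev: "eigenvalue (map_mat ?h ?B) (e I)" if "I \<in> increasing_lists n j" for I
    unfolding eigenvalue_root_char_poly[OF cB] cp poly_prod_linear_eq_0_iff set_index_sets
    using that by blast
  have "order (?h l) (char_poly (map_mat ?h ?B)) = 1"
    using l unfolding order_char_poly_of_real[OF B] simple_eigenvalue_def by blast
  then have "card {I \<in> increasing_lists n j. e I = ?h l} = 1"
    unfolding cp order_prod_linear[OF distinct_index_sets] set_index_sets .
  then obtain I1 where I1: "{I \<in> increasing_lists n j. e I = ?h l} = {I1}"
    by (auto simp: card_1_singleton_iff)
  note up = upt_in_increasing_lists[OF j]
  have le: "cmod (e I) \<le> cmod (e [0..<j])" if I: "I \<in> increasing_lists n j" for I
    unfolding e_def prod_list_increasing[OF I] prod_list_increasing[OF up] prod_norm[symmetric]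
    using increasing_lists_nth_ge[OF I] increasing_listsD(4)[OF I] by (intro prod_mono) (auto intro: dec)
  have "I1 \<in> increasing_lists n j" "e I1 = ?h l" using I1 by blast+
  with le[of I1] have "l \<le> cmod (e [0..<j])" by simp
  with dom[OF ev[OF up]] have e0: "e [0..<j] = ?h l" by (meson not_le)
  have "e [0..<j] = (\<Prod>i<j. T $$ (i, i))"
    unfolding e_def prod_list_increasing[OF up] by simp
  then show "(\<Prod>i<j. T $$ (i, i)) = of_real l" using e0 by (rule subst)
  show "cmod (\<Prod>i\<leftarrow>I. T $$ (i, i)) < l" if I: "I \<in> increasing_lists n j" "I \<noteq> [0..<j]" for I
  proof -
    have "I \<in> {I1}" if "e I = ?h l" unfolding I1[symmetric] using I(1) that by simp
    moreover have "[0..<j] \<in> {I1}" unfolding I1[symmetric] using e0 up by simp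
    ultimately have "e I \<noteq> ?h l" using I(2) by auto
    from dom[OF ev[OF I(1)] this] show ?thesis unfolding e_def .
  qed
qed

text \<open>A Schur decomposition realises any prescribed order of the eigenvalues on the
  diagonal.\<close>

lemma sorted_schur_form:
  fixes A :: "complex mat"
  assumes A: "A \<in> carrier_mat n n"
  shows "\<exists>T. similar_mat A T \<and> upper_triangular T \<and>
    (\<forall>i k. i \<le> k \<longrightarrow> k < n \<longrightarrow> cmod (T $$ (k, k)) \<le> cmod (T $$ (i, i)))"
proof -
  obtain as where as: "char_poly A = (\<Prod>a\<leftarrow>as. [:- a, 1:])" "length as = n"
    using char_poly_factorized[OF A] by blast
  define es where "es = sort_key (\<lambda>a. - cmod a) as"
  have "mset (map (\<lambda>a. [:- a, 1:]) es) = mset (map (\<lambda>a. [:- a, 1:]) as)"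
    unfolding es_def by simp
  then have "(\<Prod>a\<leftarrow>es. [:- a, 1:]) = (\<Prod>a\<leftarrow>as. [:- a, 1:])"
    by (metis prod_mset_prod_list)
  with as have cp: "char_poly A = (\<Prod>a\<leftarrow>es. [:- a, 1:])" by simp
  obtain T P Q where "schur_decomposition A es = (T, P, Q)" by (metis prod_cases3)
  from schur_decomposition[OF A cp this]
  have sim: "similar_mat A T" and ut: "upper_triangular T" and diag: "diag_mat T = es"
    unfolding similar_mat_def by blast+
  have T: "dim_row T = n" using similar_matD[OF sim] A by auto
  have Tii: "T $$ (i, i) = es ! i" if "i < n" for i
    using that T unfolding diag[symmetric] diag_mat_def by simp
  have len: "length es = n" using as unfolding es_def by simp
  have "sorted (map (\<lambda>a. - cmod a) es)" unfolding es_def by simp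
  from sorted_nth_mono[OF this] have "cmod (es ! k) \<le> cmod (es ! i)" if "i \<le> k" "k < n" for i k
    using that len by force
  then show ?thesis using sim ut Tii by (metis le_less_trans)
qed

lemma signature_equality_compounds_imp_total:
  fixes A :: "real mat"
  assumes A: "A \<in> carrier_mat n n" and sig: "\<And>j. j \<in> {1..n} \<Longrightarrow> signature_equality (compound_mat A j)"
  shows "total_signature_equality A"
proof -
  let ?h = "complex_of_real"
  have cA: "map_mat ?h A \<in> carrier_mat n n" using A by simp
  obtain T where sim: "similar_mat (map_mat ?h A) T" and ut: "upper_triangular T"
    and Tdec: "\<forall>i k. i \<le> k \<longrightarrow> k < n \<longrightarrow> cmod (T $$ (k, k)) \<le> cmod (T $$ (i, i))"
    using sorted_schur_form[OF cA] by (elim exE conjE)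
  have T: "T \<in> carrier_mat n n" using similar_matD[OF sim] cA by auto
  define dominant where "dominant j l \<longleftrightarrow> l > 0 \<and> (\<Prod>i<j. T $$ (i, i)) = ?h l \<and>
      (\<forall>I\<in>increasing_lists n j. I \<noteq> [0..<j] \<longrightarrow> cmod (\<Prod>i\<leftarrow>I. T $$ (i, i)) < l)" for j l
  define signed where "signed j l \<longleftrightarrow> simple_eigenvalue (compound_mat A j) l \<and>
      (\<exists>X Y. eigenvector (compound_mat A j) X l \<and> eigenvector (transpose_mat (compound_mat A j)) Y l \<and>
        no_zero_coords X \<and> no_zero_coords Y \<and> Sign X = Sign Y)" for j l
  have "\<exists>l. dominant j l \<and> signed j l" if j: "j \<in> {1..n}" for j
  proof -
    obtain l X Y where l: "l > 0" "simple_eigenvalue (compound_mat A j) l"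
      and dom: "\<forall>\<mu>. eigenvalue (map_mat ?h (compound_mat A j)) \<mu> \<and> \<mu> \<noteq> ?h l \<longrightarrow> cmod \<mu> < l"
      and XY: "eigenvector (compound_mat A j) X l" "eigenvector (transpose_mat (compound_mat A j)) Y l"
        "no_zero_coords X" "no_zero_coords Y" "Sign X = Sign Y"
      using sig[OF j] unfolding signature_equality_def by (elim exE conjE)
    have "j \<le> n" using j by simp
    note res = signature_equality_compound_dominant[OF A sim ut Tdec[rule_format] this l(2)]
    have "dominant j l" unfolding dominant_def
      using res dom l(1) by simp
    moreover have "signed j l" unfolding signed_def using l(2) XY by blast
    ultimately show ?thesis by blast
  qed
  then obtain L' where L': "\<And>j. j \<in> {1..n} \<Longrightarrow> dominant j (L' j) \<and> signed j (L' j)" by metis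
  \<comment> \<open>The empty product is added at zero, so that the ratios
    \<open>L (Suc i) / L i\<close> give all diagonal entries of \<open>T\<close>, which thereby turn
    out to be real and positive.\<close>
  define L where "L j = (if j = 0 then 1 else L' j)" for j
  have Lpos: "L j > 0" and Lprod: "(\<Prod>i<j. T $$ (i, i)) = ?h (L j)" if "j \<le> n" for j
    using L'[of j] that unfolding L_def dominant_def by auto
  have Ldom: "cmod (\<Prod>i\<leftarrow>I. T $$ (i, i)) < L j"
    if "I \<in> increasing_lists n j" "I \<noteq> [0..<j]" "j \<in> {1..n}" for I j
    using L'[OF that(3)] that unfolding L_def dominant_def by auto
  have Lsig: "signed j (L j)" if "j \<in> {1..n}" for j
    using L'[OF that] that unfolding L_def by simp
  define l where "l i = L (Suc i) / L i" for i
  have lpos: "l i > 0" if "i < n" for i using Lpos[of i] Lpos[of "Suc i"] that unfolding l_def by simp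
  have Tl: "T $$ (i, i) = ?h (l i)" if i: "i < n" for i
  proof -
    have "?h (L i) * T $$ (i, i) = ?h (L (Suc i))"
      using Lprod[of i] Lprod[of "Suc i"] i by simp
    then show ?thesis using Lpos[of i] i unfolding l_def by (simp add: field_simps)
  qed
  have Ll: "L j = (\<Prod>i<j. l i)" if j: "j \<le> n" for j
  proof -
    have "?h (L j) = ?h (\<Prod>i<j. l i)"
      unfolding Lprod[OF j, symmetric] of_real_prod using Tl j by (intro prod.cong) auto
    then show ?thesis by (simp only: of_real_eq_iff)
  qed
  have step: "l (Suc i) < l i" if i: "Suc i < n" for i
  proof -
    \<comment> \<open>The closest competitor of \<open>[0..<Suc i]\<close>: the two products differ
      only in their last factor, so strict dominance compares \<open>l (Suc i)\<close> with
      \<open>l i\<close>.\<close>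
    let ?I = "[0..<i] @ [Suc i]"
    have I: "?I \<in> increasing_lists n (Suc i)"
      unfolding increasing_lists_def using i by (auto simp: sorted_wrt_append)
    have "?I \<noteq> [0..<Suc i]" by simp
    from Ldom[OF I this] have "cmod (\<Prod>k\<leftarrow>?I. T $$ (k, k)) < L (Suc i)" using i by simp
    also have "(\<Prod>k\<leftarrow>?I. T $$ (k, k)) = (\<Prod>k<i. T $$ (k, k)) * T $$ (Suc i, Suc i)"
      by (simp add: prod.distinct_set_conv_list[symmetric] lessThan_atLeast0)
    also have "\<dots> = ?h (L i * l (Suc i))" using Lprod[of i] Tl[OF i] i by simp
    finally have "L i * l (Suc i) < L i * l i"
      using Lpos[of i] lpos[OF i] i unfolding norm_of_real l_def[of i] by simp
    then show ?thesis using Lpos[of i] i by simp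
  qed
  have dec: "l k < l i" if "i < k" "k < n" for i k
    using that
  proof (induction k)
    case (Suc k)
    then show ?case using step[of k] by (cases "i = k") auto
  qed simp
  have inj: "inj_on l {..<n}" by (rule linorder_inj_onI) (auto dest: dec)
  have cp: "char_poly (map_mat ?h A) = (\<Prod>i\<leftarrow>[0..<n]. [:- ?h (l i), 1:])"
  proof -
    have "diag_mat T = map (\<lambda>i. ?h (l i)) [0..<n]"
      unfolding diag_mat_def using T Tl by simp
    then show ?thesis
      using char_poly_similar[OF sim] char_poly_upper_triangular[OF T ut] by (simp add: comp_def)
  qed
  have simple: "order (l i) (char_poly A) = 1" if i: "i < n" for i
  proof -
    have "{k \<in> set [0..<n]. ?h (l k) = ?h (l i)} = {i}"
      using inj i by (auto simp: inj_on_def)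
    then show ?thesis
      unfolding order_char_poly_of_real[OF A, symmetric] cp order_prod_linear[OF distinct_upt] by simp
  qed
  have AT: "transpose_mat A \<in> carrier_mat n n" using A by simp
  have root: "poly (char_poly A) (l i) = 0" if "i < n" for i
    using simple[OF that] by (simp add: order_root)
  then have evA: "eigenvalue A (l i)" "eigenvalue (transpose_mat A) (l i)" if "i < n" for i
    using that eigenvalue_root_char_poly[OF A] eigenvalue_root_char_poly[OF AT] char_poly_transpose_mat[OF A]
    by auto
  then obtain x y' where x: "\<And>i. i < n \<Longrightarrow> eigenvector A (x i) (l i)"
    and y': "\<And>i. i < n \<Longrightarrow> eigenvector (transpose_mat A) (y' i) (l i)"
    unfolding eigenvalue_def by metis
  have y'c: "y' i \<in> carrier_vec n" if "i < n" for i
    using y'[OF that] A unfolding eigenvector_def by auto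
  define v where "v j = ext_prod n (map x [0..<j])" for j
  define w where "w j = ext_prod n (map y' [0..<j])" for j
  \<comment> \<open>By simplicity the wedges are multiples of a pair \<open>X\<close>,
    \<open>Y\<close> with equal signs, so their sign patterns agree up to the sign of the product of
    the two factors.\<close>
  have "\<exists>s::real. \<bar>s\<bar> = 1 \<and> (\<forall>a<n choose j. v j $ a \<noteq> 0 \<and> w j $ a \<noteq> 0 \<and> sgn (v j $ a) = s * sgn (w j $ a))"
    if j: "j \<in> {1..n}" for j
  proof -
    let ?B = "compound_mat A j" and ?m = "n choose j"
    have jn: "j \<le> n" using j by simp
    have B: "?B \<in> carrier_mat ?m ?m" and BT: "transpose_mat ?B \<in> carrier_mat ?m ?m" using A by auto
    have m: "?m > 0" using jn by (simp add: zero_less_binomial)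
    obtain X Y where s: "simple_eigenvalue ?B (L j)" and X: "eigenvector ?B X (L j)"
      and Y: "eigenvector (transpose_mat ?B) Y (L j)"
      and nz: "no_zero_coords X" "no_zero_coords Y" and S: "Sign X = Sign Y"
      using Lsig[OF j] unfolding signed_def by blast
    have Xc: "X \<in> carrier_vec ?m" "?B *\<^sub>v X = L j \<cdot>\<^sub>v X"
      and Yc: "Y \<in> carrier_vec ?m" "transpose_mat ?B *\<^sub>v Y = L j \<cdot>\<^sub>v Y"
      using X Y carrier_matD[OF B] unfolding eigenvector_def by auto
    have YX: "Y \<bullet> X > 0" by (rule Sign_eq_scalar_prod_pos[OF Xc(1) Yc(1) m nz(1) S])
    have XY: "X \<bullet> Y > 0" using YX comm_scalar_prod[OF Xc(1) Yc(1)] by simp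
    have ord: "order (L j) (char_poly ?B) = 1" "order (L j) (char_poly (transpose_mat ?B)) = 1"
      using s char_poly_transpose_mat[OF B] unfolding simple_eigenvalue_def by auto
    have "eigenvector ?B (v j) (L j)"
      unfolding v_def Ll[OF jn] by (rule ext_prod_eigenvector[OF A x inj jn])
    then have vc: "v j \<in> carrier_vec ?m" "v j \<noteq> 0\<^sub>v ?m" "?B *\<^sub>v v j = L j \<cdot>\<^sub>v v j"
      using carrier_matD[OF B] unfolding eigenvector_def by auto
    have "eigenvector (transpose_mat ?B) (w j) (L j)"
      unfolding w_def Ll[OF jn] compound_mat_transpose[OF A, symmetric]
      by (rule ext_prod_eigenvector[OF AT y' inj jn])
    then have wc: "w j \<in> carrier_vec ?m" "w j \<noteq> 0\<^sub>v ?m" "transpose_mat ?B *\<^sub>v w j = L j \<cdot>\<^sub>v w j"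
      using carrier_matD[OF BT] unfolding eigenvector_def by auto
    have Lj: "L j \<noteq> 0" using Lpos[OF jn] by simp
    obtain c where c: "v j = c \<cdot>\<^sub>v X"
      using simple_eigenvector_unique[OF B Xc(1) Yc(1) Xc(2) _ Lj ord(1) vc(1,3)] YX by auto
    obtain c' where c': "w j = c' \<cdot>\<^sub>v Y"
      using simple_eigenvector_unique[OF BT Yc(1) Xc(1) Yc(2) _ Lj ord(2) wc(1,3)] XY by auto
    have "c \<noteq> 0" "c' \<noteq> 0" using c c' vc(2) wc(2) Xc(1) Yc(1) by auto
    then have "\<bar>sgn c * sgn c'\<bar> = 1" by (simp add: abs_mult abs_sgn_eq)
    moreover have "v j $ a \<noteq> 0 \<and> w j $ a \<noteq> 0 \<and> sgn (v j $ a) = sgn c * sgn c' * sgn (w j $ a)"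
      if a: "a < ?m" for a
    proof -
      have "X $ a \<noteq> 0" "Y $ a \<noteq> 0" using nz a Xc Yc unfolding no_zero_coords_def by auto
      moreover have "sgn c' * sgn c' = 1" using \<open>c' \<noteq> 0\<close> by (simp add: sgn_if)
      moreover have "v j $ a = c * X $ a" "w j $ a = c' * Y $ a"
        using c c' a Xc(1) Yc(1) by auto
      ultimately show ?thesis
        using Sign_eq_sgn[OF S Xc(1) Yc(1) a] \<open>c \<noteq> 0\<close> \<open>c' \<noteq> 0\<close>
        by (simp add: sgn_mult mult.assoc)
    qed
    ultimately show ?thesis by blast
  qed
  then obtain s' :: "nat \<Rightarrow> real" where s': "\<And>j. j \<in> {1..n} \<Longrightarrow> \<bar>s' j\<bar> = 1 \<and>
      (\<forall>a<n choose j. v j $ a \<noteq> 0 \<and> w j $ a \<noteq> 0 \<and> sgn (v j $ a) = s' j * sgn (w j $ a))"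
    by metis
  define s where "s j = (if j = 0 then 1 else s' j)" for j
  have ss: "s j * s j = 1" if "j \<le> n" for j
  proof -
    have "\<bar>s j\<bar> = 1" using s'[of j] that unfolding s_def by simp
    then show ?thesis by (metis abs_mult_self_eq mult_1)
  qed
  \<comment> \<open>Since \<open>s 0 = 1\<close> and every \<open>s j\<close> squares to one, the
    product of these factors over \<open>i < j\<close> telescopes to \<open>s j\<close>, exactly the
    correction that the wedge of length \<open>j\<close> needs.\<close>
  define y where "y i = (s (Suc i) * s i) \<cdot>\<^sub>v y' i" for i
  have telescope: "(\<Prod>i<j. s (Suc i) * s i) = s j" if "j \<le> n" for j
    using that
  proof (induction j)
    case (Suc j)
    have "(\<Prod>i<Suc j. s (Suc i) * s i) = s j * s j * s (Suc j)" using Suc by simp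
    then show ?case using ss[of j] Suc.prems by simp
  qed (simp add: s_def)
  have ext_y: "ext_prod n (map y [0..<j]) = s j \<cdot>\<^sub>v w j" if "j \<le> n" for j
    unfolding y_def w_def telescope[OF that, symmetric]
    by (rule ext_prod_scale) (use y'c that in auto)
  have y: "eigenvector (transpose_mat A) (y i) (l i)" if i: "i < n" for i
  proof -
    have y'i: "y' i \<noteq> 0\<^sub>v n" "transpose_mat A *\<^sub>v y' i = l i \<cdot>\<^sub>v y' i"
      using y'[OF i] A unfolding eigenvector_def by auto
    have "s (Suc i) * s i \<noteq> 0" using ss[of i] ss[of "Suc i"] i by auto
    then have "y i \<noteq> 0\<^sub>v n" using y'i(1) y'c[OF i] unfolding y_def by (auto simp: vec_eq_iff)
    moreover have "transpose_mat A *\<^sub>v y i = l i \<cdot>\<^sub>v y i"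
      unfolding y_def mult_mat_vec[OF AT y'c[OF i]] y'i(2) by (simp add: smult_smult_assoc mult.commute)
    ultimately show ?thesis unfolding eigenvector_def using AT A y'c[OF i] unfolding y_def by auto
  qed
  have dA: "dim_row A = n" using A by simp
  have final: "no_zero_coords (ext_prod n (map x [0..<j])) \<and> no_zero_coords (ext_prod n (map y [0..<j])) \<and>
      Sign (ext_prod n (map x [0..<j])) = Sign (ext_prod n (map y [0..<j]))" if j: "j \<in> {1..n}" for j
  proof -
    have jn: "j \<le> n" using j by simp
    have dims: "dim_vec (v j) = n choose j" "dim_vec (w j) = n choose j" unfolding v_def w_def by auto
    have sj: "s j = s' j" using j unfolding s_def by simp
    have s1: "\<bar>s j\<bar> = 1" and vw: "\<And>a. a < n choose j \<Longrightarrow>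
        v j $ a \<noteq> 0 \<and> w j $ a \<noteq> 0 \<and> sgn (v j $ a) = s j * sgn (w j $ a)"
      using s'[OF j] unfolding sj by auto
    have "s j = 1 \<or> s j = -1" using s1 by linarith
    then have "sgn (s j) = s j" "s j \<noteq> 0" by auto
    then have "Sign (v j) = Sign (s j \<cdot>\<^sub>v w j)"
      unfolding Sign_def using vw dims by (intro eq_vecI) (auto simp: sgn_mult)
    moreover have "no_zero_coords (v j)" "no_zero_coords (s j \<cdot>\<^sub>v w j)"
      unfolding no_zero_coords_def using vw dims \<open>s j \<noteq> 0\<close> by auto
    ultimately show ?thesis unfolding ext_y[OF jn] v_def[symmetric] by blast
  qed
  show ?thesis
    unfolding total_signature_equality_def Let_def dA simple_eigenvalue_def
    by (intro exI[of _ l] exI[of _ x] exI[of _ y] conjI allI impI ballI)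
       (use simple evA lpos x y dec final in auto)
qed

theorem theorem13:
  fixes A :: "real mat" and n :: nat
  assumes "A \<in> carrier_mat n n"
  shows "(total_signature_equality A \<longleftrightarrow> (\<forall>j \<in> {1..n}. signature_equality (compound A j)))
       \<and> ((\<forall>j \<in> {1..n}. signature_equality (compound A j)) \<longleftrightarrow> (\<forall>j \<in> {1..n}. eventually_SJS (compound A j)))
       \<and> ((\<forall>j \<in> {1..n}. eventually_SJS (compound A j)) \<longleftrightarrow> eventually_STJS A)"
proof (intro conjI)
  note A = assms and C = compound_eq_compound_mat[OF assms]
  show "total_signature_equality A \<longleftrightarrow> (\<forall>j \<in> {1..n}. signature_equality (compound A j))"
    unfolding C
    using total_signature_equality_imp_compound[OF A] signature_equality_compounds_imp_total[OF A] by blast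
  have "signature_equality (compound A j) \<longleftrightarrow> eventually_SJS (compound A j)" if "j \<in> {1..n}" for j
  proof -
    have "n choose j > 0" using that by (simp add: zero_less_binomial)
    then show ?thesis unfolding C
      using eventually_SJS_imp_signature_equality[OF compound_mat_carrier[OF A, of j]]
        signature_equality_imp_eventually_SJS[OF compound_mat_carrier[OF A, of j]] by blast
  qed
  then show "(\<forall>j \<in> {1..n}. signature_equality (compound A j)) \<longleftrightarrow> (\<forall>j \<in> {1..n}. eventually_SJS (compound A j))"
    by blast
  have "compound (A ^\<^sub>m k) j = compound A j ^\<^sub>m k" for k j
    unfolding C compound_eq_compound_mat[OF pow_carrier_mat[OF A]] by (rule compound_mat_pow[OF A])
  moreover have "dim_row (A ^\<^sub>m k) = n" for k using carrier_matD(1)[OF pow_carrier_mat[OF A, of k]] .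
  ultimately have STJS: "STJS (A ^\<^sub>m k) \<longleftrightarrow> (\<forall>j\<in>{1..n}. SJS (compound A j ^\<^sub>m k))" for k
    unfolding STJS_def by simp
  \<comment> \<open>There are finitely many \<open>j\<close>, so their thresholds have a common
    bound.\<close>
  show "(\<forall>j \<in> {1..n}. eventually_SJS (compound A j)) \<longleftrightarrow> eventually_STJS A"
    unfolding eventually_SJS_def eventually_STJS_def STJS eventually_sequentially[symmetric]
    by (auto simp: eventually_ball_finite_distrib)
qed

end
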